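(* There is a polynomial-time algorithm that, given a graph $G$, computes its local star arboricity $\mathrm{sa}_\ell(G)$.
   Context: All graphs are finite and simple. A star forest is a forest each of whose components is a star. The local star arboricity $\mathrm{sa}_\ell(G)$ is the minimum, over all families of star forests $S_1,\dots,S_k$ that are subgraphs of $G$ and whose edge sets together cover $E(G)$ ($k$ arbitrary), of the maximum over vertices $v$ of $G$ of the number of indices $i$ with $v\in V(S_i)$. *)

theory Defs
  imports Main "HOL-Computational_Algebra.Polynomial"
begin

section \<open>Finite simple graphs\<close>

text \<open>A graph is a pair of a vertex set and a set of two-element edges.\<close>

type_synonym 'a graph = "'a set \<times> 'a set set"

abbreviation verts :: "'a graph \<Rightarrow> 'a set" where "verts \<equiv> fst"

abbreviation edges :: "'a graph \<Rightarrow> 'a set set" where "edges \<equiv> snd"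

definition simple_graph :: "'a graph \<Rightarrow> bool" where
  "simple_graph G \<longleftrightarrow> finite (verts G) \<and>
     (\<forall>e \<in> edges G. \<exists>u \<in> verts G. \<exists>v \<in> verts G. u \<noteq> v \<and> e = {u, v})"

definition subgraph :: "'a graph \<Rightarrow> 'a graph \<Rightarrow> bool" where
  "subgraph H G \<longleftrightarrow> simple_graph H \<and> verts H \<subseteq> verts G \<and> edges H \<subseteq> edges G"

definition induced_subgraph :: "'a graph \<Rightarrow> 'a set \<Rightarrow> 'a graph" where
  "induced_subgraph G C = (C, {e \<in> edges G. e \<subseteq> C})"

definition adjacency :: "'a graph \<Rightarrow> ('a \<times> 'a) set" where
  "adjacency G = {(u, v). {u, v} \<in> edges G}"

definition components :: "'a graph \<Rightarrow> 'a graph set" where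
  "components G = (\<lambda>v. induced_subgraph G {w. (v, w) \<in> (adjacency G)\<^sup>*}) ` verts G"

definition is_cycle :: "'a graph \<Rightarrow> 'a list \<Rightarrow> bool" where
  "is_cycle G vs \<longleftrightarrow> 3 \<le> length vs \<and> distinct vs \<and>
     (\<forall>i < length vs. {vs ! i, vs ! (Suc i mod length vs)} \<in> edges G)"

definition forest :: "'a graph \<Rightarrow> bool" where
  "forest G \<longleftrightarrow> (\<nexists>vs. is_cycle G vs)"

text \<open>The stars are the graphs \<open>K\<^bsub>1,r\<^esub>\<close> with \<open>r \<ge> 0\<close>. Allowing the one-vertex star
  does not affect the local star arboricity, since isolated vertices of a star forest
  cover no edge.\<close>

definition star :: "'a graph \<Rightarrow> bool" where
  "star G \<longleftrightarrow> (\<exists>c \<in> verts G. edges G = {{c, v} | v. v \<in> verts G - {c}})"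

definition star_forest :: "'a graph \<Rightarrow> bool" where
  "star_forest G \<longleftrightarrow> forest G \<and> (\<forall>C \<in> components G. star C)"


section \<open>Local star arboricity\<close>

text \<open>Families are lists, so a star forest may occur several times and each occurrence
  counts.\<close>

definition star_forest_cover :: "'a graph \<Rightarrow> 'a graph list \<Rightarrow> bool" where
  "star_forest_cover G Ss \<longleftrightarrow>
     (\<forall>S \<in> set Ss. subgraph S G \<and> star_forest S) \<and> (\<Union>S \<in> set Ss. edges S) = edges G"

text \<open>The inserted \<open>0\<close> only matters for the graph without vertices.\<close>

definition cover_locality :: "'a graph \<Rightarrow> 'a graph list \<Rightarrow> nat" where
  "cover_locality G Ss =
     Max (insert 0 ((\<lambda>v. card {i. i < length Ss \<and> v \<in> verts (Ss ! i)}) ` verts G))"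

definition local_star_arboricity :: "'a graph \<Rightarrow> nat" where
  "local_star_arboricity G = (LEAST m. \<exists>Ss. star_forest_cover G Ss \<and> cover_locality G Ss = m)"


section \<open>Polynomial-time computation\<close>

text \<open>The machine model is the random-access machine, programmed by structured control flow.
  A state assigns a natural number to every register; \<^term>\<open>Load\<close> and \<^term>\<open>Store\<close> provide
  indirect addressing. The cost is one time unit per elementary operation and per test.
  The arithmetic is restricted to addition and (truncated) subtraction: without
  multiplication, each step adds at most one bit to the largest number in memory, so this
  unit-cost measure is polynomially related to the running time of Turing machines.\<close>

type_synonym state = "nat \<Rightarrow> nat"

datatype com =
    Skip
  | Const nat nat
  | Add nat nat nat
  | Sub nat nat nat
  | Load nat nat
  | Store nat nat
  | Seq com com
  | IfNZ nat com com
  | WhileNZ nat com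

inductive exec :: "com \<Rightarrow> state \<Rightarrow> nat \<Rightarrow> state \<Rightarrow> bool" where
  Skip: "exec Skip s 1 s"
| Const: "exec (Const i k) s 1 (s(i := k))"
| Add: "exec (Add i j k) s 1 (s(i := s j + s k))"
| Sub: "exec (Sub i j k) s 1 (s(i := s j - s k))"
| Load: "exec (Load i j) s 1 (s(i := s (s j)))"
| Store: "exec (Store i j) s 1 (s(s i := s j))"
| Seq: "exec c1 s t1 s' \<Longrightarrow> exec c2 s' t2 s'' \<Longrightarrow> exec (Seq c1 c2) s (t1 + t2) s''"
| IfTrue: "s i \<noteq> 0 \<Longrightarrow> exec c1 s t s' \<Longrightarrow> exec (IfNZ i c1 c2) s (Suc t) s'"
| IfFalse: "s i = 0 \<Longrightarrow> exec c2 s t s' \<Longrightarrow> exec (IfNZ i c1 c2) s (Suc t) s'"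
| WhileFalse: "s i = 0 \<Longrightarrow> exec (WhileNZ i c) s 1 s"
| WhileTrue: "s i \<noteq> 0 \<Longrightarrow> exec c s t1 s' \<Longrightarrow> exec (WhileNZ i c) s' t2 s'' \<Longrightarrow>
    exec (WhileNZ i c) s (Suc (t1 + t2)) s''"

text \<open>The input is a bit string: register \<open>0\<close> holds its length, register \<open>i + 1\<close> its
  \<open>i\<close>-th bit, and all other registers are \<open>0\<close>.\<close>

definition input_state :: "bool list \<Rightarrow> state" where
  "input_state x r =
     (if r = 0 then length x else if r \<le> length x then of_bool (x ! (r - 1)) else 0)"

text \<open>Here \<open>enc a x\<close> means that the bit string \<open>x\<close> represents the instance \<open>a\<close>. An instance
  may have several representations, and the program has to give the right answer on all of
  them. The answer is left in register \<open>0\<close>.\<close>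

definition computes_in_poly_time :: "com \<Rightarrow> ('i \<Rightarrow> bool list \<Rightarrow> bool) \<Rightarrow> ('i \<Rightarrow> nat) \<Rightarrow> bool" where
  "computes_in_poly_time p enc f \<longleftrightarrow>
     (\<exists>q :: nat poly. \<forall>a x. enc a x \<longrightarrow>
        (\<exists>t s. exec p (input_state x) t s \<and> t \<le> poly q (length x) \<and> s 0 = f a))"

text \<open>The row-major adjacency matrix with respect to an enumeration of the vertices.\<close>

definition adjacency_bits :: "'a graph \<Rightarrow> 'a list \<Rightarrow> bool list" where
  "adjacency_bits G vs = concat (map (\<lambda>u. map (\<lambda>v. {u, v} \<in> edges G) vs) vs)"

definition encodes_graph :: "'a graph \<Rightarrow> bool list \<Rightarrow> bool" where
  "encodes_graph G x \<longleftrightarrow> simple_graph G \<and>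
     (\<exists>vs. distinct vs \<and> set vs = verts G \<and> x = adjacency_bits G vs)"

end

theory Submission imports Defs begin

text \<open>Cutting star forests into stars and orienting every edge towards the centre of its star shows
  that \<open>sa\<^sub>l(G) \<le> k\<close> holds iff \<open>G\<close> has an orientation in which every vertex \<open>v\<close> has outdegree at most
  \<open>c(v) = k - [deg v > k]\<close>. By Hakimi's theorem this fails iff some vertex set \<open>R\<close> spans more than
  \<open>c(R)\<close> edges.

  Instead of a flow computation, a load-balancing iteration decides this. Every vertex keeps an
  overload \<open>x(v)\<close>, initially \<open>0\<close>. In a round every edge sends two units of load to the endpoint of
  smaller overload (one to each in case of a tie), and \<open>x(v)\<close> becomes \<open>x(v) + load(v) - 2 c(v)\<close>,
  truncated at \<open>0\<close>. If an orientation exists, \<open>\<Sum> x\<^sup>2\<close> grows by at most \<open>4 n\<^sup>3\<close> per round; otherwise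
  \<open>\<Sum> x\<close> over a violating set grows by at least \<open>2\<close>. After more than \<open>n\<^sup>4\<close> rounds the two cases are
  told apart by the value of \<open>\<Sum> x\<close>. The answer is the number of \<open>k < n\<close> that fail.\<close>

section \<open>Orientations and load balancing\<close>

text \<open>Induction on the edges: the new edge \<open>e\<close> is charged to an endpoint
  \<open>w\<close>, whose budget drops by one. If this breaks the counting condition for both
  endpoints, two tight sets arise, one through \<open>u\<close> only and one through
  \<open>v\<close> only. Supermodularity of the number of spanned edges then contradicts the
  condition for their union, which also spans \<open>e\<close>. Budgets are integers, so the drop
  involves no truncation.\<close>

lemma Hakimi_orientation:
  fixes c :: "'a \<Rightarrow> int"
  assumes "finite E" "finite V" "\<forall>e\<in>E. \<exists>u\<in>V. \<exists>v\<in>V. e = {u, v}"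
    and "\<And>R. R \<subseteq> V \<Longrightarrow> int (card {e \<in> E. e \<subseteq> R}) \<le> sum c R"
  shows "\<exists>h. (\<forall>e\<in>E. h e \<in> e) \<and> (\<forall>v\<in>V. int (card {e \<in> E. h e = v}) \<le> c v)"
  using assms(1,3,4)
proof (induction E arbitrary: c rule: finite_induct)
  case empty
  have "0 \<le> c v" if "v \<in> V" for v
    using empty.prems(2)[of "{v}"] that by simp
  then show ?case by simp
next
  case (insert e E)
  define i where "i R = int (card {e \<in> E. e \<subseteq> R})" for R
  from insert.prems(1) obtain u v where e: "u \<in> V" "v \<in> V" "e = {u, v}" by blast
  have i_insert: "i R + of_bool (e \<subseteq> R) \<le> sum c R" if "R \<subseteq> V" for R
  proof -
    have "{e' \<in> insert e E. e' \<subseteq> R} = (if e \<subseteq> R then insert e {e \<in> E. e \<subseteq> R} else {e \<in> E. e \<subseteq> R})"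
      by auto
    with insert.prems(2)[OF that] insert.hyps show ?thesis
      by (auto simp: i_def split: if_splits)
  qed
  have c_upd: "(\<Sum>z\<in>R. c z - of_bool (z = w)) = sum c R - of_bool (w \<in> R)" if "R \<subseteq> V" for R w
    using finite_subset[OF that assms(2)] by (simp add: sum_subtractf of_bool_def)
  have "\<exists>w\<in>e. \<forall>R\<subseteq>V. i R \<le> (\<Sum>z\<in>R. c z - of_bool (z = w))"
  proof (rule ccontr)
    assume "\<not> ?thesis"
    then have "\<exists>R\<subseteq>V. sum c R - of_bool (w \<in> R) < i R" if "w \<in> e" for w
      using that c_upd by (metis not_less)
    then obtain A B where AB: "A \<subseteq> V" "sum c A - of_bool (u \<in> A) < i A"
      "B \<subseteq> V" "sum c B - of_bool (v \<in> B) < i B"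
      using e by (metis insertI1 insertI2)
    \<comment> \<open>On sets containing \<open>e\<close> the condition leaves one unit of slack. So
      a violated set contains the charged endpoint, misses the other one, and was tight before the
      drop.\<close>
    have A: "u \<in> A" "v \<notin> A" "sum c A \<le> i A"
      using i_insert[OF AB(1)] AB(2) e by (cases "u \<in> A"; cases "v \<in> A"; simp)+
    have B: "v \<in> B" "u \<notin> B" "sum c B \<le> i B"
      using i_insert[OF AB(3)] AB(4) e by (cases "u \<in> B"; cases "v \<in> B"; simp)+
    have "card {e \<in> E. e \<subseteq> A} + card {e \<in> E. e \<subseteq> B}
        = card ({e \<in> E. e \<subseteq> A} \<union> {e \<in> E. e \<subseteq> B}) + card ({e \<in> E. e \<subseteq> A} \<inter> {e \<in> E. e \<subseteq> B})"
      by (rule card_Un_Int) (simp_all add: insert.hyps)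
    also have "\<dots> \<le> card {e \<in> E. e \<subseteq> A \<union> B} + card {e \<in> E. e \<subseteq> A \<inter> B}"
      by (intro add_mono card_mono) (auto simp: insert.hyps)
    finally have "i A + i B \<le> i (A \<union> B) + i (A \<inter> B)" by (simp add: i_def)
    moreover have "sum c (A \<union> B) + sum c (A \<inter> B) = sum c A + sum c B"
      using sum.union_inter[of A B c] AB assms(2) finite_subset by metis
    moreover have "e \<subseteq> A \<union> B" using A B e by blast
    then have "i (A \<union> B) + 1 \<le> sum c (A \<union> B)"
      using i_insert[of "A \<union> B"] AB by simp
    moreover have "i (A \<inter> B) \<le> sum c (A \<inter> B)"
      using i_insert[of "A \<inter> B"] AB(1) B(2) e(3) by (simp add: le_infI1)
    ultimately show False using A(3) B(3) by linarith
  qed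
  then obtain w where w: "w \<in> e" "\<And>R. R \<subseteq> V \<Longrightarrow> i R \<le> (\<Sum>z\<in>R. c z - of_bool (z = w))" by blast
  obtain h where h: "\<forall>e\<in>E. h e \<in> e"
    "\<forall>z\<in>V. int (card {e \<in> E. h e = z}) \<le> c z - of_bool (z = w)"
    using insert.IH[of "\<lambda>z. c z - of_bool (z = w)"] insert.prems(1) w(2) unfolding i_def by auto
  have "int (card {e' \<in> insert e E. (h(e := w)) e' = z}) \<le> c z" if "z \<in> V" for z
  proof -
    have "{e' \<in> insert e E. (h(e := w)) e' = z} =
      (if z = w then insert e {e \<in> E. h e = z} else {e \<in> E. h e = z})"
      using insert.hyps by auto
    then show ?thesis using h(2)[rule_format, OF that] insert.hyps by (auto split: if_splits)
  qed
  then show ?case using h(1) w(1) insert.hyps by (intro exI[of _ "h(e := w)"]) auto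
qed

definition degree_in :: "'a graph \<Rightarrow> 'a \<Rightarrow> nat" where
  "degree_in G v = card {u \<in> verts G. {v, u} \<in> edges G}"

text \<open>\<open>h\<close> sends every edge to its tail, so the counted edges are those leaving
  \<open>v\<close>.\<close>

definition orientable :: "'a graph \<Rightarrow> ('a \<Rightarrow> nat) \<Rightarrow> bool" where
  "orientable G c \<longleftrightarrow>
     (\<exists>h. (\<forall>e\<in>edges G. h e \<in> e) \<and> (\<forall>v\<in>verts G. card {e \<in> edges G. h e = v} \<le> c v))"

text \<open>Two units per edge keep the splitting of ties integral: the two indicators add up to 2,
  1 or 0.\<close>

definition load :: "'a graph \<Rightarrow> ('a \<Rightarrow> nat) \<Rightarrow> 'a \<Rightarrow> nat" where
  "load G x v = (\<Sum>u | u \<in> verts G \<and> {v, u} \<in> edges G. of_bool (x v < x u) + of_bool (x v \<le> x u))"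

text \<open>The factor 2 matches the two units per edge. Truncation is deliberate: compared with the
  exact difference it never lowers a value and never increases a square, so both growth estimates
  survive it.\<close>

definition rebalance :: "'a graph \<Rightarrow> ('a \<Rightarrow> nat) \<Rightarrow> ('a \<Rightarrow> nat) \<Rightarrow> 'a \<Rightarrow> nat" where
  "rebalance G c x v = x v + load G x v - 2 * c v"

definition overload :: "'a graph \<Rightarrow> ('a \<Rightarrow> nat) \<Rightarrow> nat \<Rightarrow> 'a \<Rightarrow> nat" where
  "overload G c r = (rebalance G c ^^ r) (\<lambda>_. 0)"

lemma overload_0 [simp]: "overload G c 0 = (\<lambda>_. 0)"
  and overload_Suc: "overload G c (Suc r) = rebalance G c (overload G c r)"
  by (simp_all add: overload_def)

lemma edge_neq: "simple_graph G \<Longrightarrow> {u, v} \<in> edges G \<Longrightarrow> u \<noteq> v"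
  unfolding simple_graph_def by fastforce

lemma edgeE:
  assumes "simple_graph G" "e \<in> edges G"
  obtains u v where "u \<in> verts G" "v \<in> verts G" "u \<noteq> v" "e = {u, v}"
  using assms unfolding simple_graph_def by blast

lemma edge_subset_verts: "simple_graph G \<Longrightarrow> e \<in> edges G \<Longrightarrow> e \<subseteq> verts G"
  by (auto elim: edgeE)

lemma finite_verts: "simple_graph G \<Longrightarrow> finite (verts G)"
  by (simp add: simple_graph_def)

lemma finite_edges: "simple_graph G \<Longrightarrow> finite (edges G)"
  by (rule finite_subset[of _ "Pow (verts G)"]) (auto simp: finite_verts dest: edge_subset_verts)

text \<open>Each edge inside \<open>R\<close> comes from exactly two ordered pairs. This turns sums
  of loads over vertices into sums of what the single edges contribute.\<close>

lemma sum_ordered_pairs_eq_sum_edges: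
  fixes f :: "'a \<Rightarrow> 'a \<Rightarrow> nat"
  assumes G: "simple_graph G" and R: "R \<subseteq> verts G"
  shows "(\<Sum>v\<in>R. \<Sum>u | u \<in> R \<and> {v, u} \<in> edges G. f v u)
    = (\<Sum>e | e \<in> edges G \<and> e \<subseteq> R. \<Sum>v\<in>e. \<Sum>u\<in>e - {v}. f v u)"
proof -
  define S where "S = (SIGMA v:R. {u \<in> R. {v, u} \<in> edges G})"
  have fin: "finite R" using G R finite_subset finite_verts by blast
  then have finS: "finite S" by (simp add: S_def)
  have "(\<Sum>v\<in>R. \<Sum>u | u \<in> R \<and> {v, u} \<in> edges G. f v u) = (\<Sum>(v, u)\<in>S. f v u)"
    using fin by (simp add: S_def sum.Sigma)
  also have "\<dots> = (\<Sum>e | e \<in> edges G \<and> e \<subseteq> R. \<Sum>(v, u) | (v, u) \<in> S \<and> {v, u} = e. f v u)"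
  proof -
    have "(\<lambda>(v, u). {v, u}) ` S \<subseteq> {e \<in> edges G. e \<subseteq> R}" by (auto simp: S_def)
    from sum.group[OF finS _ this, of "\<lambda>(v, u). f v u"] show ?thesis
      by (simp add: finite_edges[OF G] case_prod_unfold)
  qed
  also have "\<dots> = (\<Sum>e | e \<in> edges G \<and> e \<subseteq> R. \<Sum>v\<in>e. \<Sum>u\<in>e - {v}. f v u)"
  proof (rule sum.cong[OF refl])
    fix e assume "e \<in> {e \<in> edges G. e \<subseteq> R}"
    then have e: "e \<in> edges G" "e \<subseteq> R" by auto
    obtain a b where ab: "a \<noteq> b" "e = {a, b}" using edgeE[OF G e(1)] .
    have "{(v, u). (v, u) \<in> S \<and> {v, u} = e} = {(a, b), (b, a)}"
      using e ab by (auto simp: S_def doubleton_eq_iff insert_commute)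
    then show "(\<Sum>(v, u) | (v, u) \<in> S \<and> {v, u} = e. f v u) = (\<Sum>v\<in>e. \<Sum>u\<in>e - {v}. f v u)"
      using ab by (simp add: insert_Diff_if)
  qed
  finally show ?thesis .
qed

lemma load_le:
  assumes "simple_graph G" shows "load G x v \<le> 2 * card (verts G)"
proof -
  have "load G x v \<le> (\<Sum>u | u \<in> verts G \<and> {v, u} \<in> edges G. 2)"
    unfolding load_def by (intro sum_mono) auto
  also have "\<dots> \<le> 2 * card (verts G)"
    using assms by (simp add: finite_verts card_mono)
  finally show ?thesis .
qed

text \<open>An edge adds two units to \<^const>\<open>load\<close>, all of it at its endpoint of smaller \<open>x\<close>, so no
  orientation gives a smaller weighted load.\<close>

lemma load_weighted_le:
  assumes G: "simple_graph G" and "orientable G c"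
  shows "(\<Sum>v\<in>verts G. x v * load G x v) \<le> (\<Sum>v\<in>verts G. x v * (2 * c v))"
proof -
  obtain h where h: "\<forall>e\<in>edges G. h e \<in> e" "\<forall>v\<in>verts G. card {e \<in> edges G. h e = v} \<le> c v"
    using assms(2) by (auto simp: orientable_def)
  have "(\<Sum>v\<in>verts G. x v * load G x v) = (\<Sum>e | e \<in> edges G \<and> e \<subseteq> verts G. \<Sum>v\<in>e. \<Sum>u\<in>e - {v}.
      x v * (of_bool (x v < x u) + of_bool (x v \<le> x u)))"
    using sum_ordered_pairs_eq_sum_edges[OF G order.refl,
        of "\<lambda>v u. x v * (of_bool (x v < x u) + of_bool (x v \<le> x u))"]
    by (simp add: load_def sum_distrib_left)
  also have "{e. e \<in> edges G \<and> e \<subseteq> verts G} = edges G" using edge_subset_verts[OF G] by auto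
  also have "(\<Sum>e\<in>edges G. \<Sum>v\<in>e. \<Sum>u\<in>e - {v}. x v * (of_bool (x v < x u) + of_bool (x v \<le> x u)))
      \<le> (\<Sum>e\<in>edges G. 2 * x (h e))"
  proof (rule sum_mono)
    fix e assume e: "e \<in> edges G"
    obtain a b where ab: "a \<noteq> b" "e = {a, b}" using edgeE[OF G e] .
    have "h e = a \<or> h e = b" using h(1) e ab by auto
    then show "(\<Sum>v\<in>e. \<Sum>u\<in>e - {v}. x v * (of_bool (x v < x u) + of_bool (x v \<le> x u))) \<le> 2 * x (h e)"
      using ab by (auto simp: insert_Diff_if)
  qed
  also have "\<dots> = (\<Sum>v\<in>verts G. \<Sum>e | e \<in> edges G \<and> h e = v. 2 * x (h e))"
    by (rule sum.group[symmetric])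
      (use h(1) edge_subset_verts[OF G] in \<open>auto simp: finite_edges[OF G] finite_verts[OF G]\<close>)
  also have "\<dots> = (\<Sum>v\<in>verts G. x v * (2 * card {e \<in> edges G. h e = v}))"
    by (simp add: mult_ac)
  also have "\<dots> \<le> (\<Sum>v\<in>verts G. x v * (2 * c v))"
    using h(2) by (intro sum_mono) simp
  finally show ?thesis .
qed

text \<open>Cauchy-Schwarz, by summing \<open>2 * (a * b) \<le> a\<^sup>2 + b\<^sup>2\<close> over
  all pairs.\<close>

lemma square_sum_le:
  fixes f :: "'a \<Rightarrow> nat"
  shows "(sum f A)\<^sup>2 \<le> card A * (\<Sum>a\<in>A. (f a)\<^sup>2)"
proof -
  have "2 * (a * b) \<le> a\<^sup>2 + b\<^sup>2" for a b :: nat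
  proof -
    have "int (2 * (a * b)) \<le> int (a\<^sup>2 + b\<^sup>2)"
      using zero_le_power2[of "int a - int b"] by (simp add: power2_diff)
    then show ?thesis by linarith
  qed
  then have "(\<Sum>a\<in>A. \<Sum>b\<in>A. 2 * (f a * f b)) \<le> (\<Sum>a\<in>A. \<Sum>b\<in>A. (f a)\<^sup>2 + (f b)\<^sup>2)"
    by (intro sum_mono) auto
  also have "\<dots> = 2 * (card A * (\<Sum>a\<in>A. (f a)\<^sup>2))"
    unfolding sum.distrib sum_constant sum_distrib_left[symmetric] by simp
  also have "(\<Sum>a\<in>A. \<Sum>b\<in>A. 2 * (f a * f b)) = 2 * (\<Sum>a\<in>A. \<Sum>b\<in>A. f a * f b)"
    by (simp only: sum_distrib_left)
  also have "\<dots> = 2 * (sum f A)\<^sup>2"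
    by (simp only: power2_eq_square sum_product)
  finally show ?thesis by simp
qed

text \<open>If \<open>d\<close> is the load minus twice the capacity, a square grows by at most
  \<open>2 * x * d + d\<^sup>2\<close>. The cross terms sum to at most 0 by
  \<open>load_weighted_le\<close>. As \<open>d\<close> is at most \<open>2 * n\<close> in absolute
  value, the rest is at most \<open>4 * n\<^sup>2\<close> per vertex, hence \<open>4 * n ^ 3\<close>
  per round.\<close>

lemma overload_square_sum_le:
  assumes G: "simple_graph G" and "orientable G c"
    and c: "\<And>v. v \<in> verts G \<Longrightarrow> c v \<le> card (verts G)"
  shows "(\<Sum>v\<in>verts G. (overload G c r v)\<^sup>2) \<le> 4 * card (verts G) ^ 3 * r"
proof (induction r)
  case (Suc r)
  define x where "x = overload G c r"
  define n where "n = card (verts G)"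
  \<comment> \<open>The negative half of the cross term stands on the left, so that no subtraction
    in \<open>nat\<close> occurs.\<close>
  have step: "(rebalance G c x v)\<^sup>2 + x v * (4 * c v) \<le> (x v)\<^sup>2 + 4 * n\<^sup>2 + 2 * (x v * load G x v)"
    if v: "v \<in> verts G" for v
  proof -
    define d where "d = int (load G x v) - 2 * int (c v)"
    have "\<bar>d\<bar> \<le> 2 * int n"
      using load_le[OF G, of x v] c[OF v] by (simp add: d_def n_def)
    then have "d\<^sup>2 \<le> (2 * int n)\<^sup>2" using abs_le_square_iff[of d "2 * int n"] by simp
    moreover have "(int (rebalance G c x v))\<^sup>2 \<le> (int (x v) + d)\<^sup>2"
      unfolding rebalance_def d_def by (cases "2 * c v \<le> x v + load G x v") (auto simp: of_nat_diff)
    ultimately have "int ((rebalance G c x v)\<^sup>2 + x v * (4 * c v))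
        \<le> int ((x v)\<^sup>2 + 4 * n\<^sup>2 + 2 * (x v * load G x v))"
      by (simp add: d_def power2_eq_square algebra_simps)
    then show ?thesis by linarith
  qed
  have "(\<Sum>v\<in>verts G. (rebalance G c x v)\<^sup>2) + 2 * (\<Sum>v\<in>verts G. x v * (2 * c v))
      \<le> (\<Sum>v\<in>verts G. (x v)\<^sup>2 + 4 * n\<^sup>2 + 2 * (x v * load G x v))"
    unfolding sum_distrib_left sum.distrib[symmetric]
    by (rule sum_mono) (use step in \<open>simp add: mult_ac\<close>)
  also have "\<dots> = (\<Sum>v\<in>verts G. (x v)\<^sup>2) + 4 * n ^ 3 + 2 * (\<Sum>v\<in>verts G. x v * load G x v)"
    by (simp add: sum.distrib n_def sum_distrib_left power2_eq_square power3_eq_cube)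
  finally have "(\<Sum>v\<in>verts G. (rebalance G c x v)\<^sup>2) \<le> (\<Sum>v\<in>verts G. (x v)\<^sup>2) + 4 * n ^ 3"
    using load_weighted_le[OF G assms(2), of x] by linarith
  then show ?case using Suc.IH by (simp add: overload_Suc x_def n_def algebra_simps)
qed simp

text \<open>An edge inside \<open>R\<close> places both its units in \<open>R\<close>. So in each
  round \<open>R\<close> receives at least \<open>2 * (sum c R + 1)\<close> units and gives away at
  most \<open>2 * sum c R\<close>.\<close>

lemma overload_sum_ge:
  assumes G: "simple_graph G" and R: "R \<subseteq> verts G"
    and over: "sum c R < card {e \<in> edges G. e \<subseteq> R}"
  shows "2 * r \<le> sum (overload G c r) R"
proof (induction r)
  case (Suc r)
  define x where "x = overload G c r"
  define i where "i = card {e \<in> edges G. e \<subseteq> R}"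
  have "2 * i = (\<Sum>e | e \<in> edges G \<and> e \<subseteq> R. 2)" by (simp add: i_def)
  also have "\<dots> = (\<Sum>e | e \<in> edges G \<and> e \<subseteq> R. \<Sum>v\<in>e. \<Sum>u\<in>e - {v}.
      of_bool (x v < x u) + of_bool (x v \<le> x u))"
  proof (rule sum.cong[OF refl])
    fix e assume "e \<in> {e \<in> edges G. e \<subseteq> R}"
    then have "e \<in> edges G" by simp
    then obtain a b where "a \<noteq> b" "e = {a, b}" using edgeE[OF G] by metis
    then show "2 = (\<Sum>v\<in>e. \<Sum>u\<in>e - {v}. of_bool (x v < x u) + of_bool (x v \<le> x u))"
      by (auto simp: insert_Diff_if)
  qed
  also have "\<dots> = (\<Sum>v\<in>R. \<Sum>u | u \<in> R \<and> {v, u} \<in> edges G. of_bool (x v < x u) + of_bool (x v \<le> x u))"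
    by (rule sum_ordered_pairs_eq_sum_edges[OF G R, symmetric])
  also have "\<dots> \<le> (\<Sum>v\<in>R. load G x v)"
    unfolding load_def using R by (intro sum_mono sum_mono2) (auto simp: finite_verts[OF G])
  finally have i: "2 * i \<le> (\<Sum>v\<in>R. load G x v)" .
  have "sum x R + sum (load G x) R \<le> sum (rebalance G c x) R + 2 * sum c R"
    unfolding sum.distrib[symmetric] sum_distrib_left by (rule sum_mono) (simp add: rebalance_def)
  then show ?case using i over Suc.IH by (simp add: overload_Suc x_def i_def)
qed simp

text \<open>By Cauchy-Schwarz, \<open>T > n\<^sup>4\<close> rounds separate the growth \<open>2 n\<^sup>2 \<surd>T\<close> of the total overload in the
  orientable case from the growth \<open>2 T\<close> in the other case.\<close>

lemma not_orientable_iff_overload: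
  assumes G: "simple_graph G" and c: "\<And>v. v \<in> verts G \<Longrightarrow> c v \<le> card (verts G)"
    and T: "card (verts G) ^ 4 < T"
  shows "\<not> orientable G c \<longleftrightarrow> 2 * T \<le> sum (overload G c T) (verts G)"
proof
  assume no: "\<not> orientable G c"
  have "\<exists>R\<subseteq>verts G. sum c R < card {e \<in> edges G. e \<subseteq> R}"
  proof (rule ccontr)
    assume "\<not> ?thesis"
    then have *: "card {e \<in> edges G. e \<subseteq> R} \<le> sum c R" if "R \<subseteq> verts G" for R
      using that not_less by blast
    have "\<exists>h. (\<forall>e\<in>edges G. h e \<in> e) \<and>
        (\<forall>v\<in>verts G. int (card {e \<in> edges G. h e = v}) \<le> int (c v))"
    proof (rule Hakimi_orientation)
      show "\<forall>e\<in>edges G. \<exists>u\<in>verts G. \<exists>v\<in>verts G. e = {u, v}" using edgeE[OF G] by metis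
      show "int (card {e \<in> edges G. e \<subseteq> R}) \<le> (\<Sum>v\<in>R. int (c v))" if "R \<subseteq> verts G" for R
        using *[OF that] by (simp flip: of_nat_sum)
    qed (simp_all add: finite_edges[OF G] finite_verts[OF G])
    with no show False unfolding orientable_def of_nat_le_iff by contradiction
  qed
  then obtain R where R: "R \<subseteq> verts G" "sum c R < card {e \<in> edges G. e \<subseteq> R}" by blast
  then have "2 * T \<le> sum (overload G c T) R"
    by (intro overload_sum_ge[OF G])
  also have "\<dots> \<le> sum (overload G c T) (verts G)"
    using R(1) by (intro sum_mono2) (auto simp: finite_verts[OF G])
  finally show "2 * T \<le> sum (overload G c T) (verts G)" .
next
  assume *: "2 * T \<le> sum (overload G c T) (verts G)"
  show "\<not> orientable G c"
  proof
    assume "orientable G c"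
    let ?n = "card (verts G)" and ?x = "overload G c T"
    have "(2 * T)\<^sup>2 \<le> (sum ?x (verts G))\<^sup>2" using * by (rule power_mono) simp
    also have "\<dots> \<le> ?n * (\<Sum>v\<in>verts G. (?x v)\<^sup>2)"
      by (rule square_sum_le)
    also have "\<dots> \<le> ?n * (4 * ?n ^ 3 * T)"
      by (intro mult_left_mono overload_square_sum_le[OF G \<open>orientable G c\<close> c]) auto
    also have "\<dots> = 4 * (?n ^ 4 * T)" by (simp add: power3_eq_cube power4_eq_xxxx)
    also have "\<dots> < 4 * (T * T)" using T by simp
    finally show False by (simp add: power2_eq_square)
  qed
qed


section \<open>Star forests and orientations\<close>

text \<open>Orient the edges of a star towards its centre. A centre lies in one more star than it has
  outgoing edges, but also has an incoming edge; so the centre costs a unit of the bound \<open>k\<close> only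
  at vertices of degree greater than \<open>k\<close>.\<close>

definition capacity :: "'a graph \<Rightarrow> nat \<Rightarrow> 'a \<Rightarrow> nat" where
  "capacity G k v = k - of_bool (k < degree_in G v)"

definition star_graph :: "'a \<Rightarrow> 'a set \<Rightarrow> 'a graph" where
  "star_graph c L = (insert c L, (\<lambda>v. {c, v}) ` L)"

text \<open>Every edge contains \<open>c\<close>, which rules out cycles; every other vertex is
  joined to \<open>c\<close>, so the whole graph is the only component.\<close>

lemma star_forest_star_graph:
  assumes "c \<notin> L"
  shows "star_forest (star_graph c L)"
proof -
  let ?S = "star_graph c L"
  have "forest ?S"
    unfolding forest_def
  proof
    assume "\<exists>vs. is_cycle ?S vs"
    then obtain vs where len: "3 \<le> length vs" and "distinct vs"
      and cyc: "\<And>i. i < length vs \<Longrightarrow> {vs ! i, vs ! (Suc i mod length vs)} \<in> edges ?S"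
      by (auto simp: is_cycle_def)
    have c: "c = vs ! i \<or> c = vs ! (Suc i mod length vs)" if "i < length vs" for i
      using cyc[OF that] by (auto simp: star_graph_def doubleton_eq_iff)
    have eq: "i = j" if "vs ! i = vs ! j" "i < length vs" "j < length vs" for i j
      using that \<open>distinct vs\<close> nth_eq_iff_index_eq by blast
    have ne: "vs \<noteq> []" using len by auto
    \<comment> \<open>Three consecutive edges suffice: if \<open>c\<close> is at position 1 it
      misses the third edge, otherwise it is at both 0 and 2. In a triangle the index 3 wraps around
      to 0.\<close>
    have "c = vs ! 0 \<or> c = vs ! 1" using c[of 0] len ne by auto
    moreover have "c = vs ! 1 \<or> c = vs ! 2" using c[of 1] len by (auto simp: numeral_2_eq_2)
    moreover have "c = vs ! 2 \<or> c = vs ! (3 mod length vs)"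
      using c[of 2] len by (auto simp: numeral_2_eq_2 numeral_3_eq_3)
    moreover have "3 mod length vs \<noteq> 1" "3 mod length vs < length vs"
      using len by (cases "length vs = 3"; simp)+
    ultimately show False
      using eq[of 0 1] eq[of 0 2] eq[of 1 2] eq[of 1 "3 mod length vs"] len ne by auto
  qed
  moreover have "C = ?S" if "C \<in> components ?S" for C
  proof -
    from that obtain v where v: "v \<in> insert c L"
      and C: "C = induced_subgraph ?S {w. (v, w) \<in> (adjacency ?S)\<^sup>*}"
      by (auto simp: components_def star_graph_def)
    have adj: "(c, w) \<in> adjacency ?S" "(w, c) \<in> adjacency ?S" if "w \<in> L" for w
      using that by (auto simp: adjacency_def star_graph_def insert_commute)
    have "(v, c) \<in> (adjacency ?S)\<^sup>*" using v adj by auto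
    then have "insert c L \<subseteq> {w. (v, w) \<in> (adjacency ?S)\<^sup>*}"
      using adj by (auto intro: rtrancl_into_rtrancl)
    moreover have "w \<in> insert c L" if "(v, w) \<in> (adjacency ?S)\<^sup>*" for w
      using that v by (induction rule: rtrancl_induct)
        (auto simp: adjacency_def star_graph_def doubleton_eq_iff)
    ultimately have "{w. (v, w) \<in> (adjacency ?S)\<^sup>*} = insert c L" by blast
    then show ?thesis by (auto simp: C induced_subgraph_def star_graph_def)
  qed
  moreover have "star ?S"
    using assms by (auto simp: star_def star_graph_def)
  ultimately show ?thesis unfolding star_forest_def by metis
qed

text \<open>One centre is chosen per component, so the two ends of an edge agree on it. If the
  component is a single edge, either end is a centre and the choice decides.\<close>

lemma star_forest_centers:
  assumes S: "simple_graph S" "star_forest S"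
  shows "\<exists>c. \<forall>u v. {u, v} \<in> edges S \<longrightarrow> c u = c v \<and> c u \<in> {u, v}"
proof -
  define C where "C v = induced_subgraph S {w. (v, w) \<in> (adjacency S)\<^sup>*}" for v
  define is_center where "is_center v c \<longleftrightarrow> edges (C v) = {{c, w} | w. w \<in> verts (C v) - {c}}" for v c
  \<comment> \<open>\<open>is_center v\<close> depends on \<open>v\<close> only through
    \<open>C v\<close>, so \<open>SOME\<close> picks the same centre throughout a component.\<close>
  define c where "c v = (SOME c. is_center v c)" for v
  have "c u = c v \<and> c u \<in> {u, v}" if uv: "{u, v} \<in> edges S" for u v
  proof -
    have "(u, v) \<in> adjacency S" "(v, u) \<in> adjacency S"
      using uv by (auto simp: adjacency_def insert_commute)
    then have "{w. (u, w) \<in> (adjacency S)\<^sup>*} = {w. (v, w) \<in> (adjacency S)\<^sup>*}"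
      by (auto intro: converse_rtrancl_into_rtrancl)
    then have "C u = C v" by (simp add: C_def)
    have "u \<in> verts S" using edge_subset_verts[OF S(1) uv] by simp
    then have "star (C u)"
      using S(2) by (auto simp: star_forest_def components_def C_def)
    then have "\<exists>c. is_center u c" by (auto simp: star_def is_center_def)
    then have "is_center u (c u)" unfolding c_def by (rule someI_ex)
    have "{u, v} \<in> edges (C u)"
      using uv \<open>(u, v) \<in> adjacency S\<close> by (auto simp: C_def induced_subgraph_def)
    then have "c u \<in> {u, v}"
      using \<open>is_center u (c u)\<close> by (auto simp: is_center_def doubleton_eq_iff)
    moreover have "c u = c v" using \<open>C u = C v\<close> by (simp add: c_def is_center_def)
    ultimately show ?thesis by simp
  qed
  then show ?thesis by blast
qed

text \<open>Each edge is charged to one forest \<open>idx e\<close> covering it and directed from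
  the leaf to the centre there. The out-edges of \<open>v\<close> use distinct forests through
  \<open>v\<close>, and a vertex of degree above \<open>k\<close> has an in-edge whose forest is one
  more.\<close>

lemma orientable_if_cover:
  assumes G: "simple_graph G" and cover: "star_forest_cover G Ss"
    and k: "\<And>v. v \<in> verts G \<Longrightarrow> card {i. i < length Ss \<and> v \<in> verts (Ss ! i)} \<le> k"
  shows "orientable G (capacity G k)"
proof -
  have Ss: "simple_graph (Ss ! i)" "star_forest (Ss ! i)" "edges (Ss ! i) \<subseteq> edges G"
    if "i < length Ss" for i
    using cover that by (auto simp: star_forest_cover_def subgraph_def)
  have "\<exists>i<length Ss. e \<in> edges (Ss ! i)" if "e \<in> edges G" for e
  proof -
    have "e \<in> (\<Union>S\<in>set Ss. edges S)" using cover that by (simp add: star_forest_cover_def)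
    then show ?thesis by (force simp: in_set_conv_nth)
  qed
  then obtain idx where idx: "\<And>e. e \<in> edges G \<Longrightarrow> idx e < length Ss \<and> e \<in> edges (Ss ! idx e)"
    by metis
  have "\<forall>i<length Ss. \<exists>c. \<forall>u v. {u, v} \<in> edges (Ss ! i) \<longrightarrow> c u = c v \<and> c u \<in> {u, v}"
    using star_forest_centers Ss by blast
  then obtain c where c: "\<And>i u v. i < length Ss \<Longrightarrow> {u, v} \<in> edges (Ss ! i) \<Longrightarrow>
      c i u = c i v \<and> c i u \<in> {u, v}"
    by metis
  \<comment> \<open>\<open>w\<close> is the leaf of \<open>e\<close> in its forest and will be the
    tail.\<close>
  have "\<exists>w. w \<in> e \<and> c (idx e) w \<noteq> w \<and> e = {w, c (idx e) w} \<and> (\<forall>u\<in>e. u \<noteq> w \<longrightarrow> c (idx e) u = u)"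
    if e: "e \<in> edges G" for e
  proof -
    obtain u v where uv: "u \<noteq> v" "e = {u, v}" using edgeE[OF G e] .
    then have "c (idx e) u = c (idx e) v \<and> c (idx e) u \<in> {u, v}" using c idx[OF e] by simp
    with uv show ?thesis by (auto simp: insert_commute)
  qed
  then obtain h where h: "\<And>e. e \<in> edges G \<Longrightarrow> h e \<in> e"
    "\<And>e. e \<in> edges G \<Longrightarrow> c (idx e) (h e) \<noteq> h e"
    "\<And>e. e \<in> edges G \<Longrightarrow> e = {h e, c (idx e) (h e)}"
    "\<And>e u. e \<in> edges G \<Longrightarrow> u \<in> e \<Longrightarrow> u \<noteq> h e \<Longrightarrow> c (idx e) u = u"
    by metis
  have "card {e \<in> edges G. h e = v} \<le> capacity G k v" if v: "v \<in> verts G" for v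
  proof -
    let ?O = "{e \<in> edges G. h e = v}" and ?I = "{i. i < length Ss \<and> v \<in> verts (Ss ! i)}"
    have I: "idx e \<in> ?I" if "e \<in> edges G" "v \<in> e" for e
      using idx[OF that(1)] that(2) edge_subset_verts[OF Ss(1)] by blast
    \<comment> \<open>The forest determines the out-edge: it joins \<open>v\<close> to the centre of
      its star there.\<close>
    have "inj_on idx ?O"
      by (rule inj_onI) (metis (mono_tags, lifting) h(3) mem_Collect_eq)
    then have card_O: "card ?O = card (idx ` ?O)" by (simp add: card_image)
    have sub: "idx ` ?O \<subseteq> ?I" using I h(1) by blast
    then have le: "card ?O \<le> card ?I" unfolding card_O by (intro card_mono) auto
    \<comment> \<open>With at most \<open>k\<close> out-edges, some edge at \<open>v\<close> is not
      outgoing. In its forest \<open>v\<close> is the centre, so no out-edge of \<open>v\<close> is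
      charged to that forest.\<close>
    have "card ?O < card ?I" if "k < degree_in G v"
    proof -
      let ?N = "{u \<in> verts G. {v, u} \<in> edges G}"
      have "\<not> (\<lambda>u. {v, u}) ` ?N \<subseteq> ?O"
      proof
        assume "(\<lambda>u. {v, u}) ` ?N \<subseteq> ?O"
        then have "card ?N \<le> card ?O"
          by (intro card_inj_on_le) (auto simp: inj_on_def doubleton_eq_iff finite_edges[OF G])
        with le k[OF v] that show False by (simp add: degree_in_def)
      qed
      then obtain u where u: "{v, u} \<in> edges G" "h {v, u} \<noteq> v" by blast
      have "c (idx {v, u}) v = v"
        using h(4)[OF u(1), of v] u(2) by simp
      then have "idx {v, u} \<notin> idx ` ?O"
        using h(2) by force
      then show ?thesis
        unfolding card_O using sub I[OF u(1)] by (intro psubset_card_mono) auto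
    qed
    then show ?thesis using k[OF v] le by (auto simp: capacity_def)
  qed
  with h(1) show ?thesis by (auto simp: orientable_def)
qed

text \<open>The in-edges of \<open>c\<close> form a star with leaf set \<open>L c\<close>. A vertex
  lies in one star per out-edge, and in its own star if it has an in-edge. For degree above
  \<open>k\<close> the capacity reserves room for the latter; otherwise the in-edge itself keeps the
  outdegree below \<open>k\<close>.\<close>

lemma cover_if_orientable:
  assumes G: "simple_graph G" and ori: "orientable G (capacity G k)"
  shows "\<exists>Ss. star_forest_cover G Ss \<and>
    (\<forall>v\<in>verts G. card {i. i < length Ss \<and> v \<in> verts (Ss ! i)} \<le> k)"
proof -
  from ori obtain h where h: "\<And>e. e \<in> edges G \<Longrightarrow> h e \<in> e"
    and out: "\<And>v. v \<in> verts G \<Longrightarrow> card {e \<in> edges G. h e = v} \<le> capacity G k v"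
    by (auto simp: orientable_def)
  define L where "L c = {u. {c, u} \<in> edges G \<and> h {c, u} = u}" for c
  have notin: "c \<notin> L c" for c using edge_neq[OF G, of c c] by (auto simp: L_def)
  have L_verts: "L c \<subseteq> verts G" for c using edge_subset_verts[OF G] by (force simp: L_def)
  \<comment> \<open>Stars without leaves are omitted: each would count at its centre without
    covering an edge.\<close>
  obtain cs where cs: "set cs = {c \<in> verts G. L c \<noteq> {}}" "distinct cs"
    using finite_distinct_list[of "{c \<in> verts G. L c \<noteq> {}}"] finite_verts[OF G] by auto
  define Ss where "Ss = map (\<lambda>c. star_graph c (L c)) cs"
  have "subgraph (star_graph c (L c)) G" if "c \<in> verts G" for c
    using that notin[of c] L_verts[of c] finite_subset[OF L_verts finite_verts[OF G]]
    by (fastforce simp: subgraph_def simple_graph_def star_graph_def L_def)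
  moreover have "(\<Union>S\<in>set Ss. edges S) = edges G"
  proof (intro equalityI subsetI)
    fix e assume e: "e \<in> edges G"
    obtain u v where uv: "u \<in> verts G" "v \<in> verts G" "e = {u, v}" using edgeE[OF G e] .
    then obtain c w where cw: "c \<in> verts G" "e = {c, w}" "h e = w"
      using h[OF e] by (metis insertE insert_commute singletonD)
    then have "w \<in> L c" using e by (simp add: L_def)
    then show "e \<in> (\<Union>S\<in>set Ss. edges S)"
      using cs cw by (force simp: Ss_def star_graph_def)
  qed (auto simp: Ss_def star_graph_def L_def)
  ultimately have "star_forest_cover G Ss"
    using star_forest_star_graph[OF notin] cs(1) by (auto simp: star_forest_cover_def Ss_def)
  moreover have "card {i. i < length Ss \<and> v \<in> verts (Ss ! i)} \<le> k" if v: "v \<in> verts G" for v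
  proof -
    let ?O = "{e \<in> edges G. h e = v}" and ?M = "{c. v \<in> L c}" and ?N = "{u \<in> verts G. {v, u} \<in> edges G}"
    have N: "finite ?N" by (simp add: finite_verts[OF G])
    have M_N: "?M \<subseteq> ?N" using edge_subset_verts[OF G] by (force simp: L_def insert_commute)
    have L_N: "L v \<subseteq> ?N" using L_verts by (auto simp: L_def)
    have "L v \<inter> ?M = {}" using edge_neq[OF G] by (auto simp: L_def insert_commute)
    then have deg: "card ?M < degree_in G v" if "L v \<noteq> {}"
      unfolding degree_in_def using that M_N L_N N by (intro psubset_card_mono) auto
    have M_O: "card ?M \<le> card ?O"
      by (rule card_inj_on_le[of "\<lambda>c. {c, v}"])
        (auto simp: inj_on_def doubleton_eq_iff L_def finite_edges[OF G])
    \<comment> \<open>For \<open>k = 0\<close> the capacity truncates to 0 and reserves nothing for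
      the own star. The tail \<open>u\<close> of an in-edge has positive outdegree, which excludes
      this case.\<close>
    have pos: "0 < k" if "L v \<noteq> {}"
    proof -
      from that obtain u where u: "{v, u} \<in> edges G" "h {v, u} = u" by (auto simp: L_def)
      then have "{e \<in> edges G. h e = u} \<noteq> {}" by blast
      then have "0 < card {e \<in> edges G. h e = u}" by (simp add: card_gt_0_iff finite_edges[OF G])
      moreover have "u \<in> verts G" using edge_subset_verts[OF G u(1)] by simp
      ultimately show ?thesis using out[of u] by (cases k) (auto simp: capacity_def)
    qed
    have "card {i. i < length Ss \<and> v \<in> verts (Ss ! i)}
        = card ((!) cs ` {i. i < length Ss \<and> v \<in> verts (Ss ! i)})"
      using cs(2) by (intro card_image[symmetric]) (auto simp: inj_on_def Ss_def nth_eq_iff_index_eq)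
    also have "\<dots> \<le> card ({c. c = v \<and> L v \<noteq> {}} \<union> ?M)"
    proof (rule card_mono)
      show "finite ({c. c = v \<and> L v \<noteq> {}} \<union> ?M)" using finite_subset[OF M_N N] by simp
      show "(!) cs ` {i. i < length Ss \<and> v \<in> verts (Ss ! i)} \<subseteq> {c. c = v \<and> L v \<noteq> {}} \<union> ?M"
        using cs(1) nth_mem[of _ cs] by (auto simp: Ss_def star_graph_def)
    qed
    also have "\<dots> \<le> card {c. c = v \<and> L v \<noteq> {}} + card ?M" by (rule card_Un_le)
    also have "\<dots> \<le> k"
      using deg pos M_O out[OF v] by (cases "L v = {}") (auto simp: capacity_def split: if_splits)
    finally show ?thesis .
  qed
  ultimately show ?thesis by blast
qed

section \<open>Local star arboricity as the number of infeasible bounds\<close>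

lemma cover_locality_le_iff:
  assumes "simple_graph G"
  shows "cover_locality G Ss \<le> k \<longleftrightarrow>
    (\<forall>v\<in>verts G. card {i. i < length Ss \<and> v \<in> verts (Ss ! i)} \<le> k)"
  using finite_verts[OF assms] by (simp add: cover_locality_def)

text \<open>Any choice of tails works, since no degree exceeds the number of vertices and so no
  capacity is lowered. This yields the cover that \<open>LEAST\<close> requires and bounds the range
  of \<open>k\<close>.\<close>

lemma orientable_card_verts:
  assumes G: "simple_graph G"
  shows "orientable G (capacity G (card (verts G)))"
proof -
  have "\<exists>v. v \<in> e" if "e \<in> edges G" for e using edgeE[OF G that] by blast
  then obtain h where h: "\<And>e. e \<in> edges G \<Longrightarrow> h e \<in> e" by metis
  have "card {e \<in> edges G. h e = v} \<le> capacity G (card (verts G)) v" for v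
  proof -
    let ?N = "{u \<in> verts G. {v, u} \<in> edges G}"
    have fin: "finite ?N" by (simp add: finite_verts[OF G])
    have "e \<in> (\<lambda>u. {v, u}) ` ?N" if e: "e \<in> edges G" "h e = v" for e
    proof -
      obtain a b where "a \<in> verts G" "b \<in> verts G" "e = {a, b}" using edgeE[OF G e(1)] .
      then show ?thesis using h[OF e(1)] e by (auto simp: insert_commute)
    qed
    then have "{e \<in> edges G. h e = v} \<subseteq> (\<lambda>u. {v, u}) ` ?N" by blast
    then have "card {e \<in> edges G. h e = v} \<le> degree_in G v"
      unfolding degree_in_def using surj_card_le[OF fin] by blast
    moreover have "degree_in G v \<le> card (verts G)"
      unfolding degree_in_def by (rule card_mono) (auto simp: finite_verts[OF G])
    ultimately show ?thesis by (simp add: capacity_def)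
  qed
  with h show ?thesis by (auto simp: orientable_def)
qed

lemma local_star_arboricity_le_iff:
  assumes G: "simple_graph G"
  shows "local_star_arboricity G \<le> k \<longleftrightarrow> orientable G (capacity G k)"
proof -
  have cover: "\<exists>Ss. star_forest_cover G Ss \<and> cover_locality G Ss \<le> k" if "orientable G (capacity G k)" for k
    using cover_if_orientable[OF G that] by (simp add: cover_locality_le_iff[OF G])
  then have "\<exists>m Ss. star_forest_cover G Ss \<and> cover_locality G Ss = m"
    using orientable_card_verts[OF G] by blast
  from LeastI_ex[OF this] obtain Ss where Ss: "star_forest_cover G Ss"
    "cover_locality G Ss = local_star_arboricity G"
    unfolding local_star_arboricity_def by blast
  show ?thesis
  proof
    assume "local_star_arboricity G \<le> k"
    then show "orientable G (capacity G k)"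
      using orientable_if_cover[OF G Ss(1)] Ss(2) cover_locality_le_iff[OF G] by metis
  next
    assume "orientable G (capacity G k)"
    then obtain Ss where "star_forest_cover G Ss" "cover_locality G Ss \<le> k" using cover by blast
    moreover from this have "local_star_arboricity G \<le> cover_locality G Ss"
      unfolding local_star_arboricity_def by (intro Least_le) blast
    ultimately show "local_star_arboricity G \<le> k" by simp
  qed
qed

text \<open>The infeasible \<open>k\<close> form an initial segment. Counting them lets the program
  use a loop of fixed length instead of stopping at the first feasible \<open>k\<close>.\<close>

lemma local_star_arboricity_eq_card:
  assumes G: "simple_graph G"
  shows "local_star_arboricity G = card {k. k < card (verts G) \<and> \<not> orientable G (capacity G k)}"
proof -
  have "local_star_arboricity G \<le> card (verts G)"
    using orientable_card_verts[OF G] local_star_arboricity_le_iff[OF G] by blast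
  then have "{k. k < card (verts G) \<and> \<not> orientable G (capacity G k)} = {..<local_star_arboricity G}"
    by (auto simp flip: local_star_arboricity_le_iff[OF G])
  then show ?thesis by simp
qed


section \<open>Running programs\<close>

abbreviation Seq_infix :: "com \<Rightarrow> com \<Rightarrow> com" (infixr ";;" 60) where
  "c1 ;; c2 \<equiv> Seq c1 c2"

text \<open>Total correctness with a time bound. Time is only bounded above, so branches of
  different length share one \<open>T\<close>.\<close>

definition runs :: "com \<Rightarrow> state \<Rightarrow> nat \<Rightarrow> (state \<Rightarrow> bool) \<Rightarrow> bool" where
  "runs c s T Q \<longleftrightarrow> (\<exists>t s'. exec c s t s' \<and> t \<le> T \<and> Q s')"

primrec loop_free :: "com \<Rightarrow> bool" where
  "loop_free Skip = True"
| "loop_free (Const i k) = True"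
| "loop_free (Add i j k) = True"
| "loop_free (Sub i j k) = True"
| "loop_free (Load i j) = True"
| "loop_free (Store i j) = True"
| "loop_free (Seq c1 c2) = (loop_free c1 \<and> loop_free c2)"
| "loop_free (IfNZ i c1 c2) = (loop_free c1 \<and> loop_free c2)"
| "loop_free (WhileNZ i c) = False"

text \<open>On loop-free programs execution becomes a function that simplification evaluates, in
  place of derivations of \<open>exec\<close>.\<close>

primrec run :: "com \<Rightarrow> state \<Rightarrow> state" where
  "run Skip s = s"
| "run (Const i k) s = s(i := k)"
| "run (Add i j k) s = s(i := s j + s k)"
| "run (Sub i j k) s = s(i := s j - s k)"
| "run (Load i j) s = s(i := s (s j))"
| "run (Store i j) s = s(s i := s j)"
| "run (Seq c1 c2) s = run c2 (run c1 s)"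
| "run (IfNZ i c1 c2) s = (if s i \<noteq> 0 then run c1 s else run c2 s)"
| "run (WhileNZ i c) s = s"

text \<open>The bound is independent of the state: a conditional is charged for both
  branches.\<close>

primrec cost :: "com \<Rightarrow> nat" where
  "cost Skip = 1"
| "cost (Const i k) = 1"
| "cost (Add i j k) = 1"
| "cost (Sub i j k) = 1"
| "cost (Load i j) = 1"
| "cost (Store i j) = 1"
| "cost (Seq c1 c2) = cost c1 + cost c2"
| "cost (IfNZ i c1 c2) = Suc (cost c1 + cost c2)"
| "cost (WhileNZ i c) = 1"

lemma runs_mono: "runs c s T Q \<Longrightarrow> T \<le> T' \<Longrightarrow> (\<And>s'. Q s' \<Longrightarrow> Q' s') \<Longrightarrow> runs c s T' Q'"
  unfolding runs_def by (meson order_trans)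

lemma runs_loop_free: "loop_free c \<Longrightarrow> Q (run c s) \<Longrightarrow> runs c s (cost c) Q"
proof -
  have "\<exists>t\<le>cost c. exec c s t (run c s)" if "loop_free c" for s
    using that
  proof (induction c arbitrary: s)
    case (Seq c1 c2)
    then obtain t1 t2 where "t1 \<le> cost c1" "exec c1 s t1 (run c1 s)"
      "t2 \<le> cost c2" "exec c2 (run c1 s) t2 (run c2 (run c1 s))"
      by (metis loop_free.simps(7))
    then show ?case by (intro exI[of _ "t1 + t2"]) (auto intro: exec.Seq)
  next
    case (IfNZ i c1 c2)
    then obtain t1 t2 where "t1 \<le> cost c1" "exec c1 s t1 (run c1 s)"
      "t2 \<le> cost c2" "exec c2 s t2 (run c2 s)"
      by (metis loop_free.simps(8))
    then show ?case
      by (intro exI[of _ "Suc (if s i \<noteq> 0 then t1 else t2)"]) (auto intro: exec.IfTrue exec.IfFalse)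
  qed (auto intro!: exI[of _ 1] exec.intros simp del: One_nat_def)
  then show "loop_free c \<Longrightarrow> Q (run c s) \<Longrightarrow> runs c s (cost c) Q"
    unfolding runs_def by blast
qed

lemma runs_Seq:
  assumes "runs c1 s T1 P" "\<And>s'. P s' \<Longrightarrow> runs c2 s' T2 Q"
  shows "runs (c1 ;; c2) s (T1 + T2) Q"
proof -
  from assms(1) obtain t1 s1 where 1: "exec c1 s t1 s1" "t1 \<le> T1" "P s1" by (auto simp: runs_def)
  from assms(2)[OF 1(3)] obtain t2 s2 where "exec c2 s1 t2 s2" "t2 \<le> T2" "Q s2"
    by (auto simp: runs_def)
  with 1 show ?thesis unfolding runs_def by (intro exI[of _ "t1 + t2"] exI[of _ s2]) (auto intro: exec.Seq)
qed

lemma runs_loop_free_Seq: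
  "loop_free c1 \<Longrightarrow> runs c2 (run c1 s) T Q \<Longrightarrow> runs (c1 ;; c2) s (cost c1 + T) Q"
  by (rule runs_Seq[OF runs_loop_free[where Q="\<lambda>s'. s' = run c1 s"]]) simp_all

lemma runs_Seq_loop_free:
  "runs c1 s T P \<Longrightarrow> loop_free c2 \<Longrightarrow> (\<And>s'. P s' \<Longrightarrow> Q (run c2 s')) \<Longrightarrow> runs (c1 ;; c2) s (T + cost c2) Q"
  by (erule runs_Seq) (simp add: runs_loop_free)

text \<open>\<open>I i\<close> describes the state after \<open>i\<close> iterations, of which there
  are exactly \<open>N\<close>. Each pays one test besides the body; the final \<open>1\<close> is
  the failing test.\<close>

lemma runs_While:
  assumes "I 0 s" "\<And>s. I N s \<Longrightarrow> s r = 0"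
    and "\<And>i s. i < N \<Longrightarrow> I i s \<Longrightarrow> s r \<noteq> 0 \<and> runs c s B (I (Suc i))"
  shows "runs (WhileNZ r c) s (N * (B + 1) + 1) (I N)"
proof -
  have "runs (WhileNZ r c) s ((N - i) * (B + 1) + 1) (I N)" if "i \<le> N" "I i s" for i s
    using that
  proof (induction "N - i" arbitrary: i s)
    case 0
    then show ?case using assms(2)[of s] unfolding runs_def
      by (auto intro!: exI[of _ 1] exI[of _ s] exec.WhileFalse simp del: One_nat_def)
  next
    case (Suc m)
    then have i: "i < N" by simp
    from assms(3)[OF i Suc.prems(2)] obtain t1 s1 where
      1: "s r \<noteq> 0" "exec c s t1 s1" "t1 \<le> B" "I (Suc i) s1" by (auto simp: runs_def)
    have "runs (WhileNZ r c) s1 ((N - Suc i) * (B + 1) + 1) (I N)"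
      using Suc.hyps i 1(4) by simp
    then obtain t2 s2 where 2: "exec (WhileNZ r c) s1 t2 s2" "t2 \<le> (N - Suc i) * (B + 1) + 1" "I N s2"
      by (auto simp: runs_def)
    have "N - i = Suc (N - Suc i)" using i by simp
    then have "Suc (t1 + t2) \<le> (N - i) * (B + 1) + 1" using 1(3) 2(2) by simp
    then show ?case
      using exec.WhileTrue[OF 1(1,2) 2(1)] 2(3) unfolding runs_def by blast
  qed
  from this[of 0] assms(1) show ?thesis by simp
qed

section \<open>Moving the input out of the working registers\<close>

primrec save_registers :: "nat \<Rightarrow> com" where
  "save_registers 0 = Skip"
| "save_registers (Suc m) =
    save_registers m ;; (Const 1 (m + 26) ;; Add 1 0 1 ;; Store 1 (m + 2))"

text \<open>The copying is unrolled because only register \<open>1\<close> may serve as scratch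
  here. The bound 23 keeps the sources \<open>2\<close> to \<open>24\<close> below the target block,
  so no source is overwritten.\<close>

lemma runs_save_registers:
  assumes "m \<le> 23"
  shows "runs (save_registers m) s (3 * m + 1) (\<lambda>s'. s' 0 = s 0 \<and> (\<forall>r. r \<noteq> 1 \<longrightarrow>
    s' r = (if s 0 + 26 \<le> r \<and> r < s 0 + 26 + m then s (r - s 0 - 24) else s r)))"
  using assms
proof (induction m)
  case 0
  show ?case by (rule runs_mono[OF runs_loop_free[where Q="\<lambda>s'. s' = s"]]) auto
next
  case (Suc m)
  from Suc.prems have m: "m \<le> 23" "m + 2 < s 0 + 26" by auto
  show ?case unfolding save_registers.simps
    by (rule runs_mono[OF runs_Seq_loop_free[OF Suc.IH[OF m(1)], where Q="\<lambda>s'. s' 0 = s 0 \<and> (\<forall>r. r \<noteq> 1 \<longrightarrow>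
    s' r = (if s 0 + 26 \<le> r \<and> r < s 0 + 26 + Suc m then s (r - s 0 - 24) else s r))"]])
     (use m in auto)
qed

definition copy_body :: com where
  "copy_body = Load 20 13 ;; Store 14 20 ;; Add 13 13 1 ;; Add 14 14 1 ;; Sub 12 12 1"

text \<open>Let \<open>L\<close> be the input length. Register \<open>25\<close> holds bit 24, which
  belongs at \<open>(L + 25) + 24 = L + 49\<close>. The count \<open>L - 24\<close> truncates to 0
  for inputs too short to reach register \<open>25\<close>.\<close>

definition copy_init :: com where
  "copy_init = Const 1 24 ;; Sub 12 0 1 ;; Const 13 25 ;; Const 1 49 ;; Add 14 0 1 ;; Const 1 1"

text \<open>The input occupies the registers that the program needs as variables. Bit
  \<open>j\<close> moves to address \<open>L + 25 + j\<close>, which frees the registers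
  \<open>1\<close> to \<open>24\<close>.\<close>

definition relocate :: com where
  "relocate = save_registers 23 ;; copy_init ;; WhileNZ 12 copy_body"

lemma copy_loop_free: "loop_free copy_body" "loop_free copy_init"
  by (simp_all add: copy_body_def copy_init_def)

text \<open>The source block ends before the target block starts, so every cell is read with its
  original value.\<close>

lemma runs_copy:
  assumes "s 12 = N" "s 13 = p" "s 14 = q" "s 1 = 1" "25 \<le> p" "p + N \<le> q"
  shows "runs (WhileNZ 12 copy_body) s (N * (cost copy_body + 1) + 1)
    (\<lambda>s'. (\<forall>r. r \<notin> {12, 13, 14, 20} \<longrightarrow> s' r = (if q \<le> r \<and> r < q + N then s (p + (r - q)) else s r)))"
proof -
  define I where "I i s' \<longleftrightarrow> s' 12 = N - i \<and> s' 13 = p + i \<and> s' 14 = q + i \<and>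
    (\<forall>r. r \<notin> {12, 13, 14, 20} \<longrightarrow> s' r = (if q \<le> r \<and> r < q + i then s (p + (r - q)) else s r))" for i s'
  have "runs (WhileNZ 12 copy_body) s (N * (cost copy_body + 1) + 1) (I N)"
  proof (rule runs_While)
    show "I 0 s" using assms by (simp add: I_def)
    show "s' 12 = 0" if "I N s'" for s' using that by (simp add: I_def)
    fix i s' assume i: "i < N" and I: "I i s'"
    have "s' (p + i) = s (p + i)" "s' 1 = 1" using I assms i by (auto simp: I_def)
    then have "I (Suc i) (run copy_body s')"
      using I i assms by (auto simp: I_def copy_body_def less_Suc_eq)
    moreover have "s' 12 \<noteq> 0" using I i by (simp add: I_def)
    ultimately show "s' 12 \<noteq> 0 \<and> runs copy_body s' (cost copy_body) (I (Suc i))"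
      by (simp add: runs_loop_free copy_loop_free)
  qed
  then show ?thesis by (rule runs_mono) (auto simp: I_def)
qed

lemma input_state_0: "input_state x 0 = length x"
  and input_state_Suc: "i < length x \<Longrightarrow> input_state x (Suc i) = of_bool (x ! i)"
  and input_state_beyond: "length x < r \<Longrightarrow> input_state x r = 0"
  by (auto simp: input_state_def)

text \<open>Register \<open>1\<close>, the first scratch register, is not saved: it holds a diagonal entry
  of the adjacency matrix.\<close>

lemma runs_relocate:
  assumes "x \<noteq> [] \<Longrightarrow> \<not> x ! 0"
  shows "runs relocate (input_state x)
    (70 + (cost copy_init + (length x * (cost copy_body + 1) + 1)))
    (\<lambda>s. s 0 = length x \<and> (\<forall>j. s (length x + 25 + j) = input_state x (Suc j)))"
proof -
  let ?L = "length x"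
  let ?P = "\<lambda>s'. s' 0 = input_state x 0 \<and> (\<forall>r. r \<noteq> 1 \<longrightarrow>
    s' r = (if input_state x 0 + 26 \<le> r \<and> r < input_state x 0 + 26 + 23
            then input_state x (r - input_state x 0 - 24) else input_state x r))"
  let ?Q = "\<lambda>s. s 0 = length x \<and> (\<forall>j. s (length x + 25 + j) = input_state x (Suc j))"
  have save: "runs (save_registers 23) (input_state x) (3 * 23 + 1) ?P"
    by (rule runs_save_registers) simp
  have copy: "runs (copy_init ;; WhileNZ 12 copy_body) s
      (cost copy_init + (?L * (cost copy_body + 1) + 1)) ?Q" if P: "?P s" for s
  proof (rule runs_loop_free_Seq)
    show "loop_free copy_init" by (rule copy_loop_free)
    define s1 where "s1 = run copy_init s"
    have s1: "s1 r = s r" if "r \<notin> {1, 12, 13, 14}" for r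
      using that by (simp add: s1_def copy_init_def)
    have regs: "s1 1 = 1" "s1 12 = ?L - 24" "s1 13 = 25" "s1 14 = ?L + 49"
      using P by (simp_all add: s1_def copy_init_def input_state_0)
    have *: "?Q s'" if s': "\<forall>r. r \<notin> {12, 13, 14, 20} \<longrightarrow>
      s' r = (if ?L + 49 \<le> r \<and> r < ?L + 49 + (?L - 24) then s1 (25 + (r - (?L + 49))) else s1 r)" for s'
    proof (intro conjI allI)
      show "s' 0 = ?L" using s' s1[of 0] P by (simp add: input_state_0)
      fix j
      have zero: "input_state x (Suc 0) = 0"
        using assms by (cases x) (auto simp: input_state_def)
      \<comment> \<open>Bit 0 is not moved but is zero; bits 1 to 23 come from the unrolled code,
        later ones from the loop, and addresses past the input are still zero.\<close>
      consider "j = 0" | "1 \<le> j" "j < 24" | "24 \<le> j" "j < ?L" | "24 \<le> j" "?L \<le> j" by linarith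
      then show "s' (?L + 25 + j) = input_state x (Suc j)"
      proof cases
        case 1
        then show ?thesis using s' s1 P zero by (simp add: input_state_0 input_state_beyond)
      next
        case 2
        then have "s' (?L + 25 + j) = s (?L + 25 + j)" using s' s1 by simp
        also have "\<dots> = input_state x (?L + 25 + j - ?L - 24)"
          using P 2 by (simp add: input_state_0)
        finally show ?thesis by simp
      next
        case 3
        then have "s' (?L + 25 + j) = s1 (Suc j)"
          using s' by (simp add: add.commute)
        then show ?thesis using s1 P 3 by (simp add: input_state_0)
      next
        case 4
        then have "\<not> j < 24 + (?L - 24)" by simp
        then have "s' (?L + 25 + j) = s (?L + 25 + j)" using s' s1 by simp
        then show ?thesis using P 4 by (simp add: input_state_0 input_state_beyond)
      qed
    qed
    have "runs (WhileNZ 12 copy_body) s1 ((?L - 24) * (cost copy_body + 1) + 1) ?Q"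
      by (rule runs_mono[OF runs_copy[OF regs(2-4,1)]]) (use * in auto)
    then show "runs (WhileNZ 12 copy_body) (run copy_init s) (?L * (cost copy_body + 1) + 1) ?Q"
      unfolding s1_def
      by (rule runs_mono) (auto intro!: mult_le_mono1 simp del: mult_Suc_right add_Suc_right)
  qed
  have "runs relocate (input_state x) (3 * 23 + 1 + (cost copy_init + (?L * (cost copy_body + 1) + 1))) ?Q"
    unfolding relocate_def by (rule runs_Seq[OF save copy])
  then show ?thesis by simp
qed


section \<open>The load-balancing program\<close>

text \<open>Registers: \<open>0\<close> number of infeasible \<open>k\<close> so far, \<open>1\<close>, \<open>2\<close>, \<open>22\<close> the constants one, two, zero,
  \<open>3\<close> the number \<open>n\<close> of vertices, \<open>24\<close> the number \<open>T\<close> of rounds, \<open>4\<close> the threshold \<open>2 T\<close>,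
  \<open>5\<close> start of the matrix, \<open>6\<close> first unused address, \<open>7\<close> start of the current row of overloads,
  \<open>8\<close> the value \<open>k\<close>, \<open>9\<close>--\<open>12\<close> loop counters, \<open>13\<close>--\<open>15\<close> pointers to the current matrix entry,
  to \<open>x v\<close> and to \<open>x u\<close>, \<open>16\<close> and \<open>17\<close> their values, \<open>18\<close> load, \<open>19\<close> degree,
  \<open>20\<close>, \<open>21\<close>, \<open>23\<close> scratch. Every round writes its row of overloads into fresh memory, which is
  still zero.\<close>

definition scan_body :: com where
  "scan_body = Load 23 13 ;;
    IfNZ 23 (Add 19 19 1 ;; Load 17 15 ;;
      Sub 20 17 16 ;; IfNZ 20 (Add 18 18 1) Skip ;;
      Add 17 17 1 ;; Sub 20 17 16 ;; IfNZ 20 (Add 18 18 1) Skip) Skip ;;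
    Add 13 13 1 ;; Add 15 15 1 ;; Sub 12 12 1"

definition vertex_init :: com where
  "vertex_init = Load 16 14 ;; Const 18 0 ;; Const 19 0 ;; Add 15 7 22 ;; Add 12 3 22"

definition vertex_finish :: com where
  "vertex_finish = Add 21 8 8 ;; Sub 20 19 8 ;; IfNZ 20 (Sub 21 21 2) Skip ;;
    Add 16 16 18 ;; Sub 16 16 21 ;; Store 6 16 ;; Add 6 6 1 ;; Add 14 14 1 ;; Sub 11 11 1"

definition vertex_body :: com where
  "vertex_body = vertex_init ;; WhileNZ 12 scan_body ;; vertex_finish"

definition round_init :: com where
  "round_init = Add 14 7 22 ;; Add 13 5 22 ;; Add 11 3 22"

definition round_finish :: com where
  "round_finish = Add 7 7 3 ;; Sub 10 10 1"

definition round_body :: com where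
  "round_body = round_init ;; WhileNZ 11 vertex_body ;; round_finish"

definition sum_body :: com where
  "sum_body = Load 20 14 ;; Add 21 21 20 ;; Add 14 14 1 ;; Sub 11 11 1"

definition phase_init :: com where
  "phase_init = Add 7 6 22 ;; Add 6 6 3 ;; Add 10 24 22"

definition sum_init :: com where
  "sum_init = Add 14 7 22 ;; Const 21 0 ;; Add 11 3 22"

definition phase_finish :: com where
  "phase_finish = Add 21 21 1 ;; Sub 20 21 4 ;; IfNZ 20 (Add 0 0 1) Skip ;; Add 8 8 1 ;; Sub 9 9 1"

definition phase_body :: com where
  "phase_body = phase_init ;; WhileNZ 10 round_body ;; sum_init ;; WhileNZ 11 sum_body ;; phase_finish"

section \<open>Time bounds for the nested loops\<close>

definition scan_time :: "nat \<Rightarrow> nat" where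
  "scan_time n = n * (cost scan_body + 1) + 1"

definition vertex_time :: "nat \<Rightarrow> nat" where
  "vertex_time n = cost vertex_init + (scan_time n + cost vertex_finish)"

definition round_time :: "nat \<Rightarrow> nat" where
  "round_time n = cost round_init + (n * (vertex_time n + 1) + 1 + cost round_finish)"

definition phase_time :: "nat \<Rightarrow> nat \<Rightarrow> nat" where
  "phase_time n T = cost phase_init + (T * (round_time n + 1) + 1 +
     (cost sum_init + (n * (cost sum_body + 1) + 1 + cost phase_finish)))"

lemma phase_loop_free:
  "loop_free scan_body" "loop_free vertex_init" "loop_free vertex_finish" "loop_free round_init"
  "loop_free round_finish" "loop_free sum_init" "loop_free sum_body"
  "loop_free phase_init" "loop_free phase_finish"
  by (simp_all add: scan_body_def vertex_init_def vertex_finish_def round_init_def round_finish_def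
      sum_init_def sum_body_def phase_init_def phase_finish_def)

text \<open>The machine only tests for non-zero, so \<open>x < y\<close> is tested as
  \<open>y - x \<noteq> 0\<close> and \<open>x \<le> y\<close> as
  \<open>y + 1 - x \<noteq> 0\<close>. The two increments give the contribution of one edge to
  \<open>load\<close>.\<close>

lemma run_scan_body:
  assumes "s 1 = 1" "s 13 = p" "25 \<le> p" "s 15 = q" "25 \<le> q" "s p = of_bool b" "s q = y" "s 16 = x"
  shows "run scan_body s = s(23 := of_bool b, 17 := (if b then y + 1 else s 17),
    20 := (if b then y + 1 - x else s 20), 12 := s 12 - 1, 13 := p + 1, 15 := q + 1, 19 := s 19 + of_bool b,
    18 := s 18 + (if b then of_bool (x < y) + of_bool (x \<le> y) else 0))"
proof (cases b)
  case False
  then show ?thesis using assms by (simp add: scan_body_def fun_eq_iff)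
next
  case True
  consider "x < y" | "x = y" | "y < x" by linarith
  then show ?thesis
  proof cases
    case 1
    with True show ?thesis using assms by (simp add: scan_body_def fun_eq_iff)
  next
    case 2
    with True show ?thesis using assms by (simp add: scan_body_def fun_eq_iff)
  next
    case 3
    with True show ?thesis using assms by (simp add: scan_body_def fun_eq_iff)
  qed
qed

section \<open>Correctness of the loops for a fixed vertex enumeration\<close>

locale vertex_enumeration =
  fixes G :: "'a graph" and vs :: "'a list"
  assumes G: "simple_graph G" and vs: "distinct vs" "set vs = verts G"
begin

abbreviation n :: nat where "n \<equiv> length vs"

abbreviation bit :: "nat \<Rightarrow> nat \<Rightarrow> bool" where "bit i j \<equiv> {vs ! i, vs ! j} \<in> edges G"

lemma card_verts: "card (verts G) = n"
  using vs distinct_card by metis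

lemma sum_verts: "(\<Sum>u\<in>verts G. f u) = (\<Sum>j<n. f (vs ! j))"
  using sum.reindex_bij_betw[OF bij_betw_nth[OF vs(1) refl vs(2)[symmetric]], of f] by simp

lemma load_nth:
  "load G x v = (\<Sum>j<n. if {v, vs ! j} \<in> edges G
     then of_bool (x v < x (vs ! j)) + of_bool (x v \<le> x (vs ! j)) else 0)"
  by (simp add: load_def sum.inter_filter[OF finite_verts[OF G]] sum_verts)

lemma degree_in_nth: "degree_in G v = (\<Sum>j<n. of_bool ({v, vs ! j} \<in> edges G))"
proof -
  have "degree_in G v = (\<Sum>u | u \<in> verts G \<and> {v, u} \<in> edges G. 1)" by (simp add: degree_in_def)
  also have "\<dots> = (\<Sum>j<n. of_bool ({v, vs ! j} \<in> edges G))"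
    by (simp add: sum.inter_filter[OF finite_verts[OF G]] sum_verts of_bool_def del: sum_constant One_nat_def)
  finally show ?thesis .
qed

text \<open>\<open>p\<close> is the start of row \<open>i\<close> of the matrix and \<open>q\<close>
  that of the current overloads. Register \<open>13\<close> ends at the next matrix row, so it is
  set only once per round.\<close>

lemma runs_scan:
  assumes "s 1 = 1" "s 12 = n" "s 13 = p" "s 15 = q" "25 \<le> p" "25 \<le> q" "s 18 = 0" "s 19 = 0"
    and bits: "\<forall>j<n. s (p + j) = of_bool (bit i j)"
    and x: "\<forall>j<n. s (q + j) = x (vs ! j)" "s 16 = x (vs ! i)"
  shows "runs (WhileNZ 12 scan_body) s (scan_time n) (\<lambda>s'. s' 13 = p + n \<and>
    s' 18 = load G x (vs ! i) \<and> s' 19 = degree_in G (vs ! i) \<and>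
    (\<forall>r. r \<notin> {12, 13, 15, 17, 18, 19, 20, 23} \<longrightarrow> s' r = s r))"
proof -
  define I where "I m s' \<longleftrightarrow> s' 12 = n - m \<and> s' 13 = p + m \<and> s' 15 = q + m \<and>
    s' 18 = (\<Sum>j<m. if bit i j
      then of_bool (x (vs ! i) < x (vs ! j)) + of_bool (x (vs ! i) \<le> x (vs ! j)) else 0) \<and>
    s' 19 = (\<Sum>j<m. of_bool (bit i j)) \<and>
    (\<forall>r. r \<notin> {12, 13, 15, 17, 18, 19, 20, 23} \<longrightarrow> s' r = s r)" for m s'
  have "runs (WhileNZ 12 scan_body) s (scan_time n) (I n)"
    unfolding scan_time_def
  proof (rule runs_While)
    show "I 0 s" using assms by (simp add: I_def)
    show "s' 12 = 0" if "I n s'" for s' using that by (simp add: I_def)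
    fix m s' assume m: "m < n" and I: "I m s'"
    have regs: "s' (p + m) = of_bool (bit i m)" "s' (q + m) = x (vs ! m)" "s' 1 = 1"
      "s' 16 = x (vs ! i)" "s' 12 = n - m" "s' 13 = p + m" "s' 15 = q + m"
      using I assms m by (simp_all add: I_def)
    have body: "run scan_body s' = s'(23 := of_bool (bit i m),
      17 := (if bit i m then x (vs ! m) + 1 else s' 17),
      20 := (if bit i m then x (vs ! m) + 1 - x (vs ! i) else s' 20),
      12 := s' 12 - 1, 13 := p + m + 1, 15 := q + m + 1, 19 := s' 19 + of_bool (bit i m),
      18 := s' 18 + (if bit i m
        then of_bool (x (vs ! i) < x (vs ! m)) + of_bool (x (vs ! i) \<le> x (vs ! m)) else 0))"
      by (rule run_scan_body) (use regs assms(5,6) in auto)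
    have "I (Suc m) (run scan_body s')"
      unfolding body using I m by (simp add: I_def)
    moreover have "s' 12 \<noteq> 0" using I m by (simp add: I_def)
    ultimately show "s' 12 \<noteq> 0 \<and> runs scan_body s' (cost scan_body) (I (Suc m))"
      by (simp add: runs_loop_free phase_loop_free)
  qed
  then show ?thesis by (rule runs_mono) (auto simp: I_def load_nth degree_in_nth)
qed

definition config :: "nat \<Rightarrow> nat \<Rightarrow> nat \<Rightarrow> state \<Rightarrow> bool" where
  "config A k Q s \<longleftrightarrow> s 1 = 1 \<and> s 2 = 2 \<and> s 3 = n \<and> s 5 = A \<and> s 6 = Q \<and> s 8 = k \<and> s 22 = 0 \<and>
    25 \<le> A \<and> A + n * n \<le> Q \<and> (\<forall>i<n. \<forall>j<n. s (A + (i * n + j)) = of_bool (bit i j)) \<and>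
    (\<forall>r\<ge>Q. s r = 0)"

definition row :: "nat \<Rightarrow> ('a \<Rightarrow> nat) \<Rightarrow> state \<Rightarrow> bool" where
  "row X x s \<longleftrightarrow> s 7 = X \<and> (\<forall>j<n. s (X + j) = x (vs ! j))"

text \<open>The new overloads are written behind the old row, which stays intact, so all vertices
  are updated simultaneously from the same \<open>x\<close>.\<close>

lemma runs_round:
  assumes conf: "config A k (X + n) s" and row: "row X x s" and X: "A + n * n \<le> X"
  shows "runs round_body s (round_time n) (\<lambda>s'. config A k (X + n + n) s' \<and>
    row (X + n) (rebalance G (capacity G k) x) s' \<and> s' 10 = s 10 - 1 \<and>
    (\<forall>r\<in>{0, 4, 9, 24}. s' r = s r))"
proof -
  define y where "y = rebalance G (capacity G k) x"
  define J where "J i s' \<longleftrightarrow> s' 6 = X + n + i \<and> s' 11 = n - i \<and> s' 13 = A + i * n \<and> s' 14 = X + i \<and>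
    (\<forall>j<i. s' (X + n + j) = y (vs ! j)) \<and>
    (\<forall>r. r \<notin> {6, 11, 12, 13, 14, 15, 16, 17, 18, 19, 20, 21, 23} \<and> \<not> (X + n \<le> r \<and> r < X + n + i) \<longrightarrow>
      s' r = s r)" for i s'
  have regs: "s 1 = 1" "s 2 = 2" "s 3 = n" "s 5 = A" "s 6 = X + n" "s 8 = k" "s 22 = 0" "25 \<le> A" "s 7 = X"
    using conf row by (auto simp: config_def row_def)
  have X25: "25 \<le> X" using regs(8) X by simp
  have vertices: "runs (WhileNZ 11 vertex_body) (run round_init s) (n * (vertex_time n + 1) + 1) (J n)"
  proof (rule runs_While)
    show "J 0 (run round_init s)" using regs by (simp add: J_def round_init_def)
    show "s' 11 = 0" if "J n s'" for s' using that by (simp add: J_def)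
    fix i s' assume i: "i < n" and J: "J i s'"
    define s1 where "s1 = run vertex_init s'"
    have s': "s' r = s r" if "r \<in> {1, 2, 3, 5, 7, 8, 22} \<or> 25 \<le> r \<and> r < X + n" for r
      using J that X25 unfolding J_def by auto
    have s1: "s1 r = s' r" if "r \<notin> {12, 15, 16, 18, 19}" for r
      using that by (simp add: s1_def vertex_init_def)
    have s1_regs: "s1 1 = 1" "s1 12 = n" "s1 13 = A + i * n" "s1 15 = X" "s1 18 = 0" "s1 19 = 0"
      "s1 16 = x (vs ! i)"
      using J i row X25 s'[of 1] s'[of 3] s'[of 7] s'[of 22] s'[of "X + i"] regs
      by (simp_all add: s1_def vertex_init_def J_def row_def)
    have bits: "\<forall>j<n. s1 (A + i * n + j) = of_bool (bit i j)"
    proof (intro allI impI)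
      fix j assume j: "j < n"
      have "Suc i * n \<le> n * n" using i by (intro mult_le_mono1) simp
      then have "A + i * n + j < X" using j X by simp
      then have "s1 (A + i * n + j) = s (A + (i * n + j))"
        using s1[of "A + i * n + j"] s'[of "A + i * n + j"] regs(8) by (simp add: add.assoc)
      then show "s1 (A + i * n + j) = of_bool (bit i j)" using conf i j by (simp add: config_def)
    qed
    have xs: "\<forall>j<n. s1 (X + j) = x (vs ! j)"
      using row s1 s' X25 by (auto simp: row_def)
    have scan: "runs (WhileNZ 12 scan_body) s1 (scan_time n) (\<lambda>s2. s2 13 = A + i * n + n \<and>
      s2 18 = load G x (vs ! i) \<and> s2 19 = degree_in G (vs ! i) \<and>
      (\<forall>r. r \<notin> {12, 13, 15, 17, 18, 19, 20, 23} \<longrightarrow> s2 r = s1 r))"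
      by (rule runs_scan) (use s1_regs bits xs regs X25 in auto)
    have finish: "J (Suc i) (run vertex_finish s2)"
      if s2: "s2 13 = A + i * n + n \<and> s2 18 = load G x (vs ! i) \<and> s2 19 = degree_in G (vs ! i) \<and>
      (\<forall>r. r \<notin> {12, 13, 15, 17, 18, 19, 20, 23} \<longrightarrow> s2 r = s1 r)" for s2
    proof -
      have s2s: "s2 r = s' r" if "r \<notin> {12, 13, 15, 16, 17, 18, 19, 20, 23}" for r
        using s2 s1 that by simp
      have r2: "s2 1 = 1" "s2 2 = 2" "s2 8 = k" "s2 6 = X + n + i" "s2 14 = X + i" "s2 11 = n - i"
        "s2 16 = x (vs ! i)" "s2 13 = A + Suc i * n" "s2 18 = load G x (vs ! i)"
        "s2 19 = degree_in G (vs ! i)"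
        using s2s s' J regs s2 s1_regs by (auto simp: J_def)
      \<comment> \<open>The right-hand side is how the program computes the doubled capacity. For
        \<open>k = 0\<close> both sides truncate to 0.\<close>
      have "2 * capacity G k (vs ! i) = (if degree_in G (vs ! i) - k \<noteq> 0 then k + k - 2 else k + k)"
        by (auto simp: capacity_def)
      then have "y (vs ! i) = x (vs ! i) + load G x (vs ! i) -
          (if degree_in G (vs ! i) - k \<noteq> 0 then k + k - 2 else k + k)"
        by (simp add: y_def rebalance_def)
      then have fin: "run vertex_finish s2 r =
          (if r = 6 then X + n + Suc i else if r = 14 then X + Suc i else if r = 11 then n - Suc i
           else if r = X + n + i then y (vs ! i) else s2 r)" if "r \<notin> {16, 20, 21}" for r
        using that r2 X25 by (auto simp: vertex_finish_def)
      show ?thesis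
        unfolding J_def
      proof (intro conjI allI impI)
        show "run vertex_finish s2 13 = A + Suc i * n" using fin[of 13] r2 X25 by simp
        show "run vertex_finish s2 (X + n + j) = y (vs ! j)" if "j < Suc i" for j
          using fin[of "X + n + j"] s2s[of "X + n + j"] J X25 that
          by (cases "j = i") (auto simp: J_def)
        fix r assume r: "r \<notin> {6, 11, 12, 13, 14, 15, 16, 17, 18, 19, 20, 21, 23} \<and>
          \<not> (X + n \<le> r \<and> r < X + n + Suc i)"
        then have "run vertex_finish s2 r = s' r" using fin[of r] s2s[of r] by auto
        also have "\<dots> = s r" using J r by (auto simp: J_def)
        finally show "run vertex_finish s2 r = s r" .
      qed (simp_all add: fin)
    qed
    have "runs vertex_body s' (vertex_time n) (J (Suc i))"
      unfolding vertex_body_def vertex_time_def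
    proof (rule runs_loop_free_Seq)
      show "runs (WhileNZ 12 scan_body ;; vertex_finish) (run vertex_init s')
          (scan_time n + cost vertex_finish) (J (Suc i))"
        by (rule runs_Seq_loop_free[OF scan[unfolded s1_def]])
          (use finish in \<open>simp_all add: phase_loop_free s1_def\<close>)
    qed (rule phase_loop_free)
    then show "s' 11 \<noteq> 0 \<and> runs vertex_body s' (vertex_time n) (J (Suc i))"
      using J i by (simp add: J_def)
  qed
  have finish: "config A k (X + n + n) (run round_finish s') \<and>
    row (X + n) y (run round_finish s') \<and> run round_finish s' 10 = s 10 - 1 \<and>
    (\<forall>r\<in>{0, 4, 9, 24}. run round_finish s' r = s r)" if J: "J n s'" for s'
  proof -
    have s': "s' r = s r" if "r \<in> {0, 1, 2, 3, 4, 5, 7, 8, 9, 10, 22, 24} \<or> 25 \<le> r \<and> \<not> (X + n \<le> r \<and> r < X + n + n)" for r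
      using J that X25 unfolding J_def by auto
    have fin: "run round_finish s' r = (if r = 7 then X + n else if r = 10 then s 10 - 1 else s' r)" for r
      using s'[of 7] s'[of 3] s'[of 1] s'[of 10] regs by (auto simp: round_finish_def)
    have bits: "s' (A + (i * n + j)) = of_bool (bit i j)" if "i < n" "j < n" for i j
    proof -
      have "Suc i * n \<le> n * n" using that(1) by (intro mult_le_mono1) simp
      then have "A + (i * n + j) < X" using that(2) X by simp
      then show ?thesis using s'[of "A + (i * n + j)"] conf that regs(8) by (simp add: config_def)
    qed
    show ?thesis
      unfolding config_def row_def
    proof (intro conjI allI impI ballI)
      show "run round_finish s' r = 0" if "X + n + n \<le> r" for r
        using fin[of r] s'[of r] that X25 conf by (auto simp: config_def)
      show "run round_finish s' (A + (i * n + j)) = of_bool (bit i j)" if "i < n" "j < n" for i j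
        using fin[of "A + (i * n + j)"] bits[OF that] regs(8) by simp
      show "run round_finish s' (X + n + j) = y (vs ! j)" if "j < n" for j
        using fin[of "X + n + j"] J that X25 by (simp add: J_def)
      show "run round_finish s' 6 = X + n + n" using fin[of 6] J by (simp add: J_def)
      show "run round_finish s' r = s r" if "r \<in> {0, 4, 9, 24}" for r
        using fin[of r] s'[of r] that by auto
    qed (use fin s' regs X in auto)
  qed
  have "runs round_body s (round_time n) (\<lambda>s'. config A k (X + n + n) s' \<and>
    row (X + n) y s' \<and> s' 10 = s 10 - 1 \<and> (\<forall>r\<in>{0, 4, 9, 24}. s' r = s r))"
    unfolding round_body_def round_time_def
  proof (rule runs_loop_free_Seq)
    show "runs (WhileNZ 11 vertex_body ;; round_finish) (run round_init s)
      (n * (vertex_time n + 1) + 1 + cost round_finish) (\<lambda>s'. config A k (X + n + n) s' \<and>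
      row (X + n) y s' \<and> s' 10 = s 10 - 1 \<and> (\<forall>r\<in>{0, 4, 9, 24}. s' r = s r))"
      by (rule runs_Seq_loop_free[OF vertices]) (use finish in \<open>simp_all add: phase_loop_free\<close>)
  qed (rule phase_loop_free)
  then show ?thesis by (simp add: y_def)
qed

lemma runs_sum:
  assumes "s 1 = 1" "s 14 = X" "25 \<le> X" "s 11 = n" "s 21 = 0" "\<forall>j<n. s (X + j) = x (vs ! j)"
  shows "runs (WhileNZ 11 sum_body) s (n * (cost sum_body + 1) + 1)
    (\<lambda>s'. s' 21 = sum x (verts G) \<and> (\<forall>r. r \<notin> {11, 14, 20, 21} \<longrightarrow> s' r = s r))"
proof -
  define I where "I m s' \<longleftrightarrow> s' 11 = n - m \<and> s' 14 = X + m \<and> s' 21 = (\<Sum>j<m. x (vs ! j)) \<and>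
    (\<forall>r. r \<notin> {11, 14, 20, 21} \<longrightarrow> s' r = s r)" for m s'
  have "runs (WhileNZ 11 sum_body) s (n * (cost sum_body + 1) + 1) (I n)"
  proof (rule runs_While)
    show "I 0 s" using assms by (simp add: I_def)
    show "s' 11 = 0" if "I n s'" for s' using that by (simp add: I_def)
    fix m s' assume m: "m < n" and I: "I m s'"
    have "s' (X + m) = x (vs ! m)" "s' 1 = 1"
      using I assms m by (auto simp: I_def)
    then have "I (Suc m) (run sum_body s')"
      using I m by (auto simp: I_def sum_body_def)
    moreover have "s' 11 \<noteq> 0" using I m by (simp add: I_def)
    ultimately show "s' 11 \<noteq> 0 \<and> runs sum_body s' (cost sum_body) (I (Suc m))"
      by (simp add: runs_loop_free phase_loop_free)
  qed
  then show ?thesis by (rule runs_mono) (auto simp: I_def sum_verts)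
qed

end


section \<open>Correctness and running time\<close>

text \<open>The input length is \<open>n\<^sup>2\<close>, and \<open>n\<close> is recovered by subtracting successive odd numbers.\<close>

definition sqrt_init :: com where
  "sqrt_init = Const 1 1 ;; Const 2 2 ;; Const 22 0 ;; Const 3 0 ;; Const 20 1 ;; Add 12 0 22"

definition sqrt_body :: com where
  "sqrt_body = Sub 12 12 20 ;; Add 20 20 2 ;; Add 3 3 1"

text \<open>Lacking multiplication, the program adds the input length \<open>L = n * n\<close> to 1
  a total of \<open>L\<close> times. This gives \<open>T = n ^ 4 + 1\<close>, the least number of
  rounds the criterion admits.\<close>

definition square_init :: com where
  "square_init = Const 24 1 ;; Add 12 0 22"

definition square_body :: com where
  "square_body = Add 24 24 0 ;; Sub 12 12 1"

definition constants_finish :: com where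
  "constants_finish =
    Add 4 24 24 ;; Const 20 25 ;; Add 5 0 20 ;; Add 6 5 0 ;; Const 0 0 ;; Const 8 0 ;; Add 9 3 22"

definition constants :: com where
  "constants = sqrt_init ;; WhileNZ 12 sqrt_body ;; square_init ;; WhileNZ 12 square_body ;; constants_finish"

definition arboricity_program :: com where
  "arboricity_program = relocate ;; constants ;; WhileNZ 9 phase_body"

lemma constants_loop_free:
  "loop_free sqrt_init" "loop_free sqrt_body" "loop_free square_init" "loop_free square_body"
  "loop_free constants_finish"
  by (simp_all add: sqrt_init_def sqrt_body_def square_init_def square_body_def constants_finish_def)

definition relocate_time :: "nat \<Rightarrow> nat" where
  "relocate_time L = 70 + (cost copy_init + (L * (cost copy_body + 1) + 1))"

definition constants_time :: "nat \<Rightarrow> nat \<Rightarrow> nat" where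
  "constants_time n L = cost sqrt_init + (n * (cost sqrt_body + 1) + 1 + (cost square_init +
     (L * (cost square_body + 1) + 1 + cost constants_finish)))"

text \<open>\<open>n\<close> and the input length \<open>L\<close> are separate arguments; replacing
  \<open>n\<close> by \<open>L\<close> later gives a polynomial in \<open>L\<close> alone.\<close>

definition program_time :: "nat \<Rightarrow> nat \<Rightarrow> nat" where
  "program_time n L = relocate_time L + (constants_time n L + (n * (phase_time n (L * L + 1) + 1) + 1))"

lemma runs_sqrt:
  assumes "s 1 = 1" "s 2 = 2" "s 3 = 0" "s 20 = 1" "s 12 = n * n"
  shows "runs (WhileNZ 12 sqrt_body) s (n * (cost sqrt_body + 1) + 1)
    (\<lambda>s'. s' 3 = n \<and> (\<forall>r. r \<notin> {3, 12, 20} \<longrightarrow> s' r = s r))"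
proof -
  define I where "I i s' \<longleftrightarrow> s' 12 = n * n - i * i \<and> s' 20 = Suc (2 * i) \<and> s' 3 = i \<and>
    (\<forall>r. r \<notin> {3, 12, 20} \<longrightarrow> s' r = s r)" for i s'
  have "runs (WhileNZ 12 sqrt_body) s (n * (cost sqrt_body + 1) + 1) (I n)"
  proof (rule runs_While)
    show "I 0 s" using assms by (simp add: I_def)
    show "s' 12 = 0" if "I n s'" for s' using that by (simp add: I_def)
    fix i s' assume i: "i < n" and I: "I i s'"
    have "s' 1 = 1" "s' 2 = 2" using I assms by (auto simp: I_def)
    moreover have "n * n - i * i - Suc (2 * i) = n * n - Suc i * Suc i" by simp
    ultimately have "I (Suc i) (run sqrt_body s')"
      using I by (auto simp: I_def sqrt_body_def)
    moreover have "i * i < n * n" using i by (simp add: mult_strict_mono)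
    then have "s' 12 \<noteq> 0" using I by (simp add: I_def)
    ultimately show "s' 12 \<noteq> 0 \<and> runs sqrt_body s' (cost sqrt_body) (I (Suc i))"
      by (simp add: runs_loop_free constants_loop_free)
  qed
  then show ?thesis by (rule runs_mono) (auto simp: I_def)
qed

lemma runs_square:
  assumes "s 1 = 1" "s 0 = L" "s 12 = L" "s 24 = 1"
  shows "runs (WhileNZ 12 square_body) s (L * (cost square_body + 1) + 1)
    (\<lambda>s'. s' 24 = L * L + 1 \<and> (\<forall>r. r \<notin> {12, 24} \<longrightarrow> s' r = s r))"
proof -
  define I where "I i s' \<longleftrightarrow> s' 12 = L - i \<and> s' 24 = i * L + 1 \<and>
    (\<forall>r. r \<notin> {12, 24} \<longrightarrow> s' r = s r)" for i s'
  have "runs (WhileNZ 12 square_body) s (L * (cost square_body + 1) + 1) (I L)"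
  proof (rule runs_While)
    show "I 0 s" using assms by (simp add: I_def)
    show "s' 12 = 0" if "I L s'" for s' using that by (simp add: I_def)
    fix i s' assume i: "i < L" and I: "I i s'"
    have "s' 1 = 1" "s' 0 = L" using I assms by (auto simp: I_def)
    then have "I (Suc i) (run square_body s')"
      using I by (auto simp: I_def square_body_def)
    moreover have "s' 12 \<noteq> 0" using I i by (simp add: I_def)
    ultimately show "s' 12 \<noteq> 0 \<and> runs square_body s' (cost square_body) (I (Suc i))"
      by (simp add: runs_loop_free constants_loop_free)
  qed
  then show ?thesis by (rule runs_mono) (auto simp: I_def)
qed

lemma nth_concat_uniform:
  assumes "\<And>ys. ys \<in> set xss \<Longrightarrow> length ys = m" "i < length xss" "j < m"
  shows "concat xss ! (i * m + j) = xss ! i ! j"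
  using assms
proof (induction xss arbitrary: i)
  case (Cons ys xss)
  then show ?case by (cases i) (auto simp: nth_append add.assoc)
qed simp

context vertex_enumeration begin

lemma length_adjacency_bits: "length (adjacency_bits G vs) = n * n"
  by (simp add: adjacency_bits_def length_concat o_def sum_list_triv)

lemma nth_adjacency_bits: "i < n \<Longrightarrow> j < n \<Longrightarrow> adjacency_bits G vs ! (i * n + j) = bit i j"
  unfolding adjacency_bits_def by (subst nth_concat_uniform[where m = n]) auto

lemma runs_constants:
  assumes L: "s 0 = n * n"
    and bits: "\<forall>i<n. \<forall>j<n. s (n * n + 25 + (i * n + j)) = of_bool (bit i j)"
    and zero: "\<forall>r\<ge>n * n + 25 + n * n. s r = 0"
  shows "runs constants s (constants_time n (n * n)) (\<lambda>s'. config (n * n + 25) 0 (n * n + 25 + n * n) s' \<and>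
    s' 0 = 0 \<and> s' 9 = n \<and> s' 4 = 2 * (n * n * (n * n) + 1) \<and> s' 24 = n * n * (n * n) + 1)"
    (is "runs _ _ _ ?Q")
proof -
  define s1 where "s1 = run sqrt_init s"
  have s1: "s1 1 = 1" "s1 2 = 2" "s1 3 = 0" "s1 20 = 1" "s1 12 = n * n" "s1 22 = 0" "s1 0 = n * n"
    "\<And>r. 25 \<le> r \<Longrightarrow> s1 r = s r"
    using L by (simp_all add: s1_def sqrt_init_def)
  have "runs (WhileNZ 12 sqrt_body ;; square_init ;; WhileNZ 12 square_body ;; constants_finish) s1
    (n * (cost sqrt_body + 1) + 1 + (cost square_init +
     (n * n * (cost square_body + 1) + 1 + cost constants_finish))) ?Q"
  proof (rule runs_Seq[OF runs_sqrt[OF s1(1-5)]], rule runs_loop_free_Seq)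
    show "loop_free square_init" by (rule constants_loop_free)
    fix s2 assume s2: "s2 3 = n \<and> (\<forall>r. r \<notin> {3, 12, 20} \<longrightarrow> s2 r = s1 r)"
    define s3 where "s3 = run square_init s2"
    have s3: "s3 1 = 1" "s3 0 = n * n" "s3 12 = n * n" "s3 24 = 1" "s3 2 = 2" "s3 3 = n" "s3 22 = 0"
      "\<And>r. 25 \<le> r \<Longrightarrow> s3 r = s r"
      using s1 s2 by (simp_all add: s3_def square_init_def)
    have "?Q (run constants_finish s4)"
      if s4: "s4 24 = n * n * (n * n) + 1 \<and> (\<forall>r. r \<notin> {12, 24} \<longrightarrow> s4 r = s3 r)" for s4
    proof -
      have s4r: "s4 1 = 1" "s4 0 = n * n" "s4 2 = 2" "s4 3 = n" "s4 22 = 0"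
        "s4 24 = n * n * (n * n) + 1" "\<And>r. 25 \<le> r \<Longrightarrow> s4 r = s r"
        using s3 s4 by auto
      have "\<And>r. 25 \<le> r \<Longrightarrow> run constants_finish s4 r = s r"
        using s4r by (simp add: constants_finish_def)
      moreover have "run constants_finish s4 1 = 1" "run constants_finish s4 2 = 2"
        "run constants_finish s4 3 = n" "run constants_finish s4 5 = n * n + 25"
        "run constants_finish s4 6 = n * n + 25 + n * n" "run constants_finish s4 8 = 0"
        "run constants_finish s4 22 = 0" "run constants_finish s4 0 = 0" "run constants_finish s4 9 = n"
        "run constants_finish s4 4 = 2 * (n * n * (n * n) + 1)"
        "run constants_finish s4 24 = n * n * (n * n) + 1"
        using s4r by (simp_all add: constants_finish_def)
      ultimately show ?thesis
        using bits zero unfolding config_def by simp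
    qed
    then show "runs (WhileNZ 12 square_body ;; constants_finish) (run square_init s2)
      (n * n * (cost square_body + 1) + 1 + cost constants_finish) ?Q"
      by (intro runs_Seq_loop_free[OF runs_square[OF s3(1-4), unfolded s3_def]])
        (simp_all only: constants_loop_free s3_def)
  qed
  then show ?thesis
    unfolding constants_def constants_time_def s1_def
    by (intro runs_loop_free_Seq) (rule constants_loop_free)
qed

text \<open>A phase tests one \<open>k\<close>: it performs \<open>T\<close> rounds from zero
  overloads and compares the total overload with \<open>2 * T\<close>, as in
  \<open>not_orientable_iff_overload\<close>.\<close>

lemma runs_phase:
  assumes conf: "config A k Q s" and T: "s 4 = 2 * T" "s 24 = T" "n ^ 4 < T" and k: "k \<le> n"
  shows "runs phase_body s (phase_time n T) (\<lambda>s'. (\<exists>Q'. config A (Suc k) Q' s') \<and>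
    s' 4 = 2 * T \<and> s' 24 = T \<and> s' 9 = s 9 - 1 \<and>
    s' 0 = s 0 + of_bool (\<not> orientable G (capacity G k)))" (is "runs _ _ _ ?Q")
proof -
  let ?x = "overload G (capacity G k)"
  define I where "I i s' \<longleftrightarrow> (\<exists>X. config A k (X + n) s' \<and> row X (?x i) s' \<and> A + n * n \<le> X) \<and>
    s' 10 = T - i \<and> (\<forall>r\<in>{0, 4, 9, 24}. s' r = s r)" for i s'
  have regs: "s 1 = 1" "s 2 = 2" "s 3 = n" "s 5 = A" "s 6 = Q" "s 8 = k" "s 22 = 0" "25 \<le> A" "A + n * n \<le> Q"
    using conf by (auto simp: config_def)
  have rounds: "runs (WhileNZ 10 round_body) (run phase_init s) (T * (round_time n + 1) + 1) (I T)"
  proof (rule runs_While)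
    have init: "run phase_init s r =
      (if r = 7 then Q else if r = 6 then Q + n else if r = 10 then T else s r)" for r
      using regs T by (auto simp: phase_init_def)
    have "config A k (Q + n) (run phase_init s)"
      using conf regs unfolding config_def init by simp
    \<comment> \<open>The first row is placed in fresh memory, whose zeros are the initial
      overloads.\<close>
    moreover have "row Q (?x 0) (run phase_init s)"
      using conf regs unfolding row_def init config_def by simp
    ultimately show "I 0 (run phase_init s)"
      using regs unfolding I_def by (auto simp: init)
    show "s' 10 = 0" if "I T s'" for s' using that by (simp add: I_def)
    fix i s' assume i: "i < T" and I: "I i s'"
    from I obtain X where X: "config A k (X + n) s'" "row X (?x i) s'" "A + n * n \<le> X"
      by (auto simp: I_def)
    have "runs round_body s' (round_time n) (I (Suc i))"
    proof (rule runs_mono[OF runs_round[OF X] order.refl])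
      fix s'' assume *: "config A k (X + n + n) s'' \<and>
        row (X + n) (rebalance G (capacity G k) (?x i)) s'' \<and> s'' 10 = s' 10 - 1 \<and>
        (\<forall>r\<in>{0, 4, 9, 24}. s'' r = s' r)"
      then have "\<exists>X. config A k (X + n) s'' \<and> row X (?x (Suc i)) s'' \<and> A + n * n \<le> X"
        using X(3) by (intro exI[of _ "X + n"]) (simp add: overload_Suc)
      with * I show "I (Suc i) s''" by (simp add: I_def)
    qed
    then show "s' 10 \<noteq> 0 \<and> runs round_body s' (round_time n) (I (Suc i))"
      using I i by (simp add: I_def)
  qed
  have test: "runs (sum_init ;; WhileNZ 11 sum_body ;; phase_finish) s2
      (cost sum_init + (n * (cost sum_body + 1) + 1 + cost phase_finish)) ?Q" if I: "I T s2" for s2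
  proof (rule runs_loop_free_Seq)
    show "loop_free sum_init" by (rule phase_loop_free)
    from I obtain X where X: "config A k (X + n) s2" "row X (?x T) s2" "A + n * n \<le> X"
      by (auto simp: I_def)
    have s2: "s2 1 = 1" "s2 3 = n" "s2 7 = X" "s2 22 = 0" "s2 8 = k" "25 \<le> X"
      "\<And>r. r \<in> {0, 4, 9, 24} \<Longrightarrow> s2 r = s r"
      using X I by (auto simp: config_def row_def I_def)
    define s3 where "s3 = run sum_init s2"
    have s3: "s3 r = (if r = 14 then X else if r = 21 then 0 else if r = 11 then n else s2 r)" for r
      using s2 by (auto simp: s3_def sum_init_def)
    have sum: "runs (WhileNZ 11 sum_body) s3 (n * (cost sum_body + 1) + 1)
      (\<lambda>s'. s' 21 = sum (?x T) (verts G) \<and> (\<forall>r. r \<notin> {11, 14, 20, 21} \<longrightarrow> s' r = s3 r))"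
      by (rule runs_sum[of _ X]) (use s2 s3 X in \<open>auto simp: row_def\<close>)
    have cap: "capacity G k v \<le> card (verts G)" for v
      using k by (simp add: capacity_def card_verts)
    have iff: "\<not> orientable G (capacity G k) \<longleftrightarrow> 2 * T \<le> sum (?x T) (verts G)"
      by (rule not_orientable_iff_overload[OF G cap]) (simp add: card_verts T)
    have "?Q (run phase_finish s4)"
      if s4: "s4 21 = sum (?x T) (verts G) \<and> (\<forall>r. r \<notin> {11, 14, 20, 21} \<longrightarrow> s4 r = s3 r)" for s4
    proof -
      have s4r: "s4 r = s2 r" if "r \<notin> {11, 14, 20, 21}" for r using s4 s3 that by simp
      \<comment> \<open>Adding 1 before the truncated subtraction makes the test succeed at equality
        too.\<close>
      have test: "s4 21 + 1 - 2 * T \<noteq> 0 \<longleftrightarrow> \<not> orientable G (capacity G k)"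
        unfolding iff using s4 by simp linarith
      have fin: "run phase_finish s4 r =
        (if r = 0 then s 0 + of_bool (\<not> orientable G (capacity G k)) else if r = 8 then Suc k
         else if r = 9 then s 9 - 1 else s2 r)" if "r \<notin> {11, 14, 20, 21}" for r
        using that test s4r[of 0] s4r[of 1] s4r[of 4] s4r[of 8] s4r[of 9] s4r[OF that] s2 T
        by (auto simp: phase_finish_def)
      have "config A (Suc k) (X + n) (run phase_finish s4)"
        using X(1) s2(6) X(3) unfolding config_def by (auto simp: fin)
      then show ?thesis using s2 T by (auto simp: fin)
    qed
    then show "runs (WhileNZ 11 sum_body ;; phase_finish) (run sum_init s2)
      (n * (cost sum_body + 1) + 1 + cost phase_finish) ?Q"
      by (intro runs_Seq_loop_free[OF sum[unfolded s3_def]]) (simp_all only: phase_loop_free s3_def)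
  qed
  show ?thesis
    unfolding phase_body_def phase_time_def
    by (intro runs_loop_free_Seq runs_Seq[OF rounds test]) (rule phase_loop_free)
qed

text \<open>Register \<open>0\<close> counts the infeasible values below the current
  \<open>k\<close>; after \<open>n\<close> phases \<open>local_star_arboricity_eq_card\<close>
  identifies this count with the answer.\<close>

lemma runs_arboricity_program:
  "runs arboricity_program (input_state (adjacency_bits G vs)) (program_time n (n * n))
    (\<lambda>s. s 0 = local_star_arboricity G)" (is "runs _ _ _ ?R")
proof -
  let ?x = "adjacency_bits G vs" and ?L = "n * n" and ?T = "n * n * (n * n) + 1"
  have diag: "\<not> ?x ! 0" if "?x \<noteq> []"
  proof -
    have "0 < n" using that length_adjacency_bits by fastforce
    then show ?thesis using nth_adjacency_bits[of 0 0] edge_neq[OF G, of "vs ! 0" "vs ! 0"] by auto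
  qed
  define K where "K k s \<longleftrightarrow> (\<exists>Q. config (?L + 25) k Q s) \<and> s 4 = 2 * ?T \<and> s 24 = ?T \<and> s 9 = n - k \<and>
    s 0 = (\<Sum>j<k. of_bool (\<not> orientable G (capacity G j)))" for k s
  have loop: "runs (WhileNZ 9 phase_body) s (n * (phase_time n ?T + 1) + 1) ?R" if "K 0 s" for s
  proof (rule runs_mono)
    show "runs (WhileNZ 9 phase_body) s (n * (phase_time n ?T + 1) + 1) (K n)"
    proof (rule runs_While)
      show "K 0 s" by fact
      show "s' 9 = 0" if "K n s'" for s' using that by (simp add: K_def)
      fix k s' assume k: "k < n" and K: "K k s'"
      have "n ^ 4 < ?T" by (simp add: power4_eq_xxxx)
      then have "runs phase_body s' (phase_time n ?T) (K (Suc k))"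
        using K k by (auto simp: K_def intro!: runs_mono[OF runs_phase[where T = ?T and s = s' and k = k]])
      then show "s' 9 \<noteq> 0 \<and> runs phase_body s' (phase_time n ?T) (K (Suc k))"
        using K k by (simp add: K_def)
    qed
    show "s' 0 = local_star_arboricity G" if "K n s'" for s'
    proof -
      have "{k. k < n \<and> \<not> orientable G (capacity G k)} = {..<n} \<inter> {k. \<not> orientable G (capacity G k)}"
        by auto
      then show ?thesis
        using that by (simp add: K_def local_star_arboricity_eq_card[OF G] card_verts sum_of_bool_eq)
    qed
  qed simp
  have constants: "runs constants s (constants_time n ?L) (K 0)"
    if s: "s 0 = length ?x \<and> (\<forall>j. s (length ?x + 25 + j) = input_state ?x (Suc j))" for s
  proof (rule runs_mono[OF runs_constants order.refl])
    show "s 0 = n * n" using s by (simp add: length_adjacency_bits)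
    show "\<forall>i<n. \<forall>j<n. s (n * n + 25 + (i * n + j)) = of_bool (bit i j)"
    proof (intro allI impI)
      fix i j assume ij: "i < n" "j < n"
      have "Suc i * n \<le> n * n" using ij(1) by (intro mult_le_mono1) simp
      then have "i * n + j < length ?x" using ij(2) by (simp add: length_adjacency_bits)
      then show "s (n * n + 25 + (i * n + j)) = of_bool (bit i j)"
        using s ij by (simp add: length_adjacency_bits input_state_Suc nth_adjacency_bits)
    qed
    show "\<forall>r\<ge>n * n + 25 + n * n. s r = 0"
    proof (intro allI impI)
      fix r assume r: "n * n + 25 + n * n \<le> r"
      then have "s (n * n + 25 + (r - (n * n + 25))) = input_state ?x (Suc (r - (n * n + 25)))"
        using s unfolding length_adjacency_bits by blast
      also have "\<dots> = 0" using r by (intro input_state_beyond) (simp add: length_adjacency_bits)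
      finally show "s r = 0" using r by simp
    qed
  qed (auto simp: K_def)
  have "runs arboricity_program (input_state ?x)
    (70 + (cost copy_init + (length ?x * (cost copy_body + 1) + 1)) +
      (constants_time n ?L + (n * (phase_time n ?T + 1) + 1))) ?R"
    unfolding arboricity_program_def
    by (rule runs_Seq[OF runs_relocate[OF diag] runs_Seq[OF constants loop]])
  then show ?thesis
    by (simp add: program_time_def relocate_time_def length_adjacency_bits)
qed

end

section \<open>A polynomial bound in the input length\<close>

definition polynomial :: "(nat \<Rightarrow> nat) \<Rightarrow> bool" where
  "polynomial f \<longleftrightarrow> (\<exists>q. \<forall>x. f x = poly q x)"

lemma polynomial_id: "polynomial (\<lambda>x. x)"
  unfolding polynomial_def by (rule exI[of _ "[:0, 1:]"]) simp

lemma polynomial_const: "polynomial (\<lambda>x. c)"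
  unfolding polynomial_def by (rule exI[of _ "[:c:]"]) simp

lemma polynomial_add: "polynomial f \<Longrightarrow> polynomial g \<Longrightarrow> polynomial (\<lambda>x. f x + g x)"
  unfolding polynomial_def by (metis poly_add)

lemma polynomial_mult: "polynomial f \<Longrightarrow> polynomial g \<Longrightarrow> polynomial (\<lambda>x. f x * g x)"
  unfolding polynomial_def by (metis poly_mult)

text \<open>The bound is built by sums and products from \<open>L\<close> and constants such as
  \<open>cost scan_body\<close>, so closure properties suffice and no coefficients are
  computed.\<close>

lemma polynomial_program_time: "polynomial (\<lambda>L. program_time L L)"
  unfolding program_time_def relocate_time_def constants_time_def phase_time_def round_time_def
    vertex_time_def scan_time_def
  by (intro polynomial_add polynomial_mult polynomial_const polynomial_id)

lemma program_time_mono: "n \<le> m \<Longrightarrow> program_time n L \<le> program_time m L"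
  unfolding program_time_def relocate_time_def constants_time_def phase_time_def round_time_def
    vertex_time_def scan_time_def
  by (intro add_le_mono mult_le_mono order.refl) assumption+

theorem theorem24:
  "\<exists>p. computes_in_poly_time p encodes_graph (local_star_arboricity :: nat graph \<Rightarrow> nat)"
proof -
  obtain q where q: "\<And>L. program_time L L = poly q L"
    using polynomial_program_time by (auto simp: polynomial_def)
  have "\<exists>t s. exec arboricity_program (input_state x) t s \<and> t \<le> poly q (length x) \<and>
      s 0 = local_star_arboricity G"
    if "encodes_graph G x" for G :: "nat graph" and x
  proof -
    from that obtain vs where "vertex_enumeration G vs" and x: "x = adjacency_bits G vs"
      by (auto simp: encodes_graph_def vertex_enumeration_def)
    then interpret vertex_enumeration G vs by simp
    obtain t s where ts: "exec arboricity_program (input_state x) t s" "t \<le> program_time n (n * n)"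
      "s 0 = local_star_arboricity G"
      using runs_arboricity_program x by (auto simp: runs_def)
    \<comment> \<open>As \<open>n \<le> n * n\<close>, the bound can be expressed through the input
      length \<open>n * n\<close> alone.\<close>
    have "program_time n (n * n) \<le> program_time (n * n) (n * n)"
      by (rule program_time_mono) (cases n; simp)
    also have "\<dots> = poly q (length x)" by (simp add: q x length_adjacency_bits)
    finally show ?thesis using ts by (meson order_trans)
  qed
  then show ?thesis unfolding computes_in_poly_time_def by blast
qed

end
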